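(* Let $p$ be a prime, $r$ a positive integer, $q=p^r$, and let $\Gamma$ be a one dimensional affine rank three graph with point set $\mathbb{F}_q$. Then $\Gamma$ or its complement is isomorphic to one of the following graphs: a Van Lint - Schrijver graph on $\mathbb{F}_q$, the Paley graph on $\mathbb{F}_q$, or a Peisert graph on $\mathbb{F}_q$.
   Context: $\mathbb{F}_q$ is the finite field of order $q=p^r$, $\mathbb{F}_q^+$ its additive group and $\mathbb{F}_q^*$ its multiplicative group. $A\Gamma L(1,q)$ is the group of permutations of $\mathbb{F}_q$ of the form $x\mapsto a\,x^{p^i}+b$ with $a\in\mathbb{F}_q^*$, $b\in\mathbb{F}_q$, $i\ge 0$. The rank of a transitive permutation group $G$ on a set $\Omega$ is the number of orbits of $G$ on $\Omega\times\Omega$; a rank three group is a transitive group of rank $3$. Graphs are undirected and loopless. A graph $\Gamma$ with point set $\mathbb{F}_q$ is a one dimensional affine rank three graph if $\mathrm{Aut}(\Gamma)\cap A\Gamma L(1,q)$ is a rank three group on $\mathbb{F}_q$; equivalently, the arc set of $\Gamma$ is one of the (non-reflexive) orbits on $\mathbb{F}_q\times\mathbb{F}_q$ of a rank three subgroup $G\le A\Gamma L(1,q)$. The complement of $\Gamma$ is the graph on $\mathbb{F}_q$ in which distinct points are adjacent iff they are not adjacent in $\Gamma$. For $S\subseteq\mathbb{F}_q^*$ with $S=-S$, $\mathrm{Cay}(\mathbb{F}_q^+,S)$ is the graph with point set $\mathbb{F}_q$ in which $x,y$ are adjacent iff $y-x\in S$. Van Lint - Schrijver graph on $\mathbb{F}_q$: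 the graph $\mathrm{Cay}(\mathbb{F}_q^+,\langle\omega^\ell\rangle)$, where $\ell$ is a prime, $\ell\neq p$, the multiplicative order of $p$ modulo $\ell$ equals $\ell-1$, $q=p^{(\ell-1)k}$ for some positive integer $k$, and $\omega$ is a generator of $\mathbb{F}_q^*$ (for $\ell=2$, when it is undirected, this is the Paley graph). Paley graph on $\mathbb{F}_q$, $q\equiv 1\pmod 4$: the graph $\mathrm{Cay}(\mathbb{F}_q^+,\langle\omega^2\rangle)$, where $\omega$ is a generator of $\mathbb{F}_q^*$ (that is, the connection set is the set of nonzero squares). Peisert graph on $\mathbb{F}_q$, where $p\equiv 3\pmod 4$ and $r$ is even: the graph $\mathrm{Cay}(\mathbb{F}_q^+,C\cup C\omega)$, where $\omega$ is a generator of $\mathbb{F}_q^*$ and $C=\langle\omega^4\rangle$. *)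

theory Defs
  imports "HOL-Library.Cardinality" "HOL-Algebra.Group_Action" "HOL-Number_Theory.Number_Theory"
begin

text \<open>
  The point set of a permutation group or of a graph is always a whole type, and a
  permutation group is a subset of \<^term>\<open>carrier (BijGroup UNIV)\<close>.
\<close>

definition perm_group :: "('a \<Rightarrow> 'a) set \<Rightarrow> ('a \<Rightarrow> 'a) monoid"
  where "perm_group G = (BijGroup UNIV)\<lparr>carrier := G\<rparr>"

definition perm_rank :: "('a \<Rightarrow> 'a) set \<Rightarrow> nat"
  where "perm_rank G = card (orbits (perm_group G) (UNIV \<times> UNIV) (\<lambda>g. map_prod g g))"

definition rank_three_group :: "('a \<Rightarrow> 'a) set \<Rightarrow> bool"
  where "rank_three_group G \<longleftrightarrow>
    subgroup G (BijGroup UNIV) \<and>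
    transitive_action (perm_group G) UNIV (\<lambda>g. g) \<and>
    perm_rank G = 3"

text \<open>
  The parameter \<open>p\<close> is the characteristic; it is kept explicit because the field
  is only known through its order \<open>p ^ r\<close>.
\<close>

definition AGammaL1 :: "nat \<Rightarrow> ('a::{field,finite} \<Rightarrow> 'a) set"
  where "AGammaL1 p = {f. \<exists>a b i. a \<noteq> 0 \<and> f = (\<lambda>x. a * x ^ (p ^ i) + b)}"

definition is_graph :: "'a rel \<Rightarrow> bool"
  where "is_graph E \<longleftrightarrow> sym E \<and> irrefl E"

definition graph_complement :: "'a rel \<Rightarrow> 'a rel"
  where "graph_complement E = {(x, y). x \<noteq> y \<and> (x, y) \<notin> E}"

definition is_graph_iso :: "('a \<Rightarrow> 'b) \<Rightarrow> 'a rel \<Rightarrow> 'b rel \<Rightarrow> bool"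
  where "is_graph_iso f E F \<longleftrightarrow> bij f \<and> (\<forall>x y. (x, y) \<in> E \<longleftrightarrow> (f x, f y) \<in> F)"

definition graph_isomorphic :: "'a rel \<Rightarrow> 'b rel \<Rightarrow> bool"
  where "graph_isomorphic E F \<longleftrightarrow> (\<exists>f. is_graph_iso f E F)"

definition graph_Aut :: "'a rel \<Rightarrow> ('a \<Rightarrow> 'a) set"
  where "graph_Aut E = {f. is_graph_iso f E E}"

definition affine_rank_three_graph :: "nat \<Rightarrow> 'a::{field,finite} rel \<Rightarrow> bool"
  where "affine_rank_three_graph p E \<longleftrightarrow>
    is_graph E \<and> rank_three_group (graph_Aut E \<inter> AGammaL1 p)"

definition Cay :: "'a::ab_group_add set \<Rightarrow> 'a rel"
  where "Cay S = {(x, y). y - x \<in> S}"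

text \<open>
  The integer powers of \<open>g\<close>.  For \<open>g = 0\<close> this is \<open>{0, 1}\<close>, so that zero is
  never a generator in the sense of the next definition.
\<close>

definition cyclic_subgroup :: "'a::field \<Rightarrow> 'a set"
  where "cyclic_subgroup g = range (\<lambda>n::int. g powi n)"

definition mult_generator :: "'a::field \<Rightarrow> bool"
  where "mult_generator \<omega> \<longleftrightarrow> cyclic_subgroup \<omega> = UNIV - {0}"

text \<open>
  The symmetry condition on the connection set makes \<^term>\<open>Cay S\<close> undirected.
  It excludes the case \<open>l = 2\<close> with \<open>q mod 4 = 3\<close> (the Paley tournaments).
\<close>

definition van_lint_schrijver_graph :: "nat \<Rightarrow> 'a::{field,finite} rel \<Rightarrow> bool"
  where "van_lint_schrijver_graph p E \<longleftrightarrow>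
    (\<exists>l k \<omega>. prime l \<and> l \<noteq> p \<and> ord l p = l - 1 \<and>
       k > 0 \<and> CARD('a) = p ^ ((l - 1) * k) \<and>
       mult_generator \<omega> \<and>
       cyclic_subgroup (\<omega> ^ l) = uminus ` cyclic_subgroup (\<omega> ^ l) \<and>
       E = Cay (cyclic_subgroup (\<omega> ^ l)))"

definition paley_graph :: "'a::{field,finite} rel \<Rightarrow> bool"
  where "paley_graph E \<longleftrightarrow>
    CARD('a) mod 4 = 1 \<and>
    (\<exists>\<omega>. mult_generator \<omega> \<and> E = Cay (cyclic_subgroup (\<omega> ^ 2)))"

definition peisert_graph :: "nat \<Rightarrow> 'a::{field,finite} rel \<Rightarrow> bool"
  where "peisert_graph p E \<longleftrightarrow>
    p mod 4 = 3 \<and> (\<exists>r. even r \<and> CARD('a) = p ^ r) \<and>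
    (\<exists>\<omega>. mult_generator \<omega> \<and>
       E = Cay (cyclic_subgroup (\<omega> ^ 4) \<union> (\<lambda>c. c * \<omega>) ` cyclic_subgroup (\<omega> ^ 4)))"

end

theory Submission
  imports Defs
begin

text \<open>
  A rank three group \<open>G\<close> of one dimensional semilinear affine maps contains all translations:
  the translations in \<open>G\<close> form a subgroup \<open>V\<close> whose cosets are permuted by \<open>G\<close>, and if \<open>V\<close> were
  proper, counting orbits would make \<open>q = p ^ r\<close> divide the number of linear parts, which is a divisor
  of \<open>q - 1\<close> times a number between \<open>1\<close> and \<open>r\<close>.  Hence the graph is a Cayley graph \<open>Cay S\<close>.

  Taking logarithms to the base of a generator turns \<open>S\<close> into a set \<open>\<Sigma>\<close> of integers, and the stabilizer of
  \<open>0\<close> into maps \<open>z \<mapsto> p ^ i * z + c\<close>.  Modulo the smallest period \<open>d\<close> of \<open>\<Sigma>\<close> these are the iterates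
  of a single map \<open>f z = a * z + c0\<close>, whose only cycles are \<open>\<Sigma>\<close> and its complement.  By the Hull--Dobell
  criterion \<open>f\<close> would be a single cycle unless one of the following holds: \<open>f\<close> moves residues but fixes one
  residue class modulo an odd prime \<open>m\<close>, and then this class is \<open>\<Sigma>\<close> or its complement and \<open>p\<close> is a primitive root
  modulo \<open>m\<close>; or \<open>f\<close> preserves parity, which is the same situation for
  \<open>m = 2\<close>; or \<open>4\<close> divides \<open>d\<close> with \<open>a mod 4 = 3\<close>, which gives the Peisert graph.
  (If \<open>f\<close> fixed all residues modulo an odd prime, there would be three invariant sets.)
\<close>

section \<open>Geometric sums modulo primes and their squares\<close>

lemma geometric_sum_mult:
  fixes a :: "'a::comm_semiring_1"
  shows "(\<Sum>i<m * n. a ^ i) = (\<Sum>i<m. a ^ i) * (\<Sum>j<n. (a ^ m) ^ j)"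
proof (induction n)
  case (Suc n)
  have "(\<Sum>i<m * Suc n. a ^ i) = (\<Sum>i<m * n. a ^ i) + (\<Sum>i=m*n..<m*n+m. a ^ i)"
    by (simp add: lessThan_atLeast0 sum.atLeastLessThan_concat add.commute)
  also have "(\<Sum>i=m*n..<m*n+m. a ^ i) = (\<Sum>i<m. a ^ i) * (a ^ m) ^ n"
    using sum.shift_bounds_nat_ivl[of "\<lambda>i. a ^ i" 0 "m * n" m]
    by (simp add: lessThan_atLeast0 power_add power_mult sum_distrib_left add.commute mult.commute)
  finally show ?case by (simp add: Suc.IH algebra_simps)
qed simp

lemma cong_geometric_sum:
  fixes a :: int
  assumes "[a = 1] (mod m)"
  shows "[(\<Sum>i<t. a ^ i) = int t] (mod m)"
proof -
  have "[(\<Sum>i<t. a ^ i) = (\<Sum>i<t. 1)] (mod m)"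
    by (rule cong_sum) (use cong_pow[OF assms] in simp)
  thus ?thesis by simp
qed

lemma one_plus_mult_power_cong:
  fixes l k :: int
  shows "[(1 + l * k) ^ i = 1 + int i * (l * k)] (mod (l\<^sup>2))"
proof (induction i)
  case (Suc i)
  have "[(1 + l * k) ^ i * (1 + l * k) = (1 + int i * (l * k)) * (1 + l * k)] (mod (l\<^sup>2))"
    using Suc by (rule cong_mult) simp
  also have "(1 + int i * (l * k)) * (1 + l * k) = 1 + int (Suc i) * (l * k) + (int i * k * k) * l\<^sup>2"
    by (simp add: algebra_simps power2_eq_square)
  also have "[\<dots> = 1 + int (Suc i) * (l * k)] (mod (l\<^sup>2))"
    by (simp add: cong_def)
  finally show ?case by (simp add: mult.commute)
qed simp

text \<open>With \<open>a = 1 + l * k\<close>, the powers of \<open>a\<close> are linear in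
  \<open>k\<close> modulo \<open>l\<^sup>2\<close>; the linear terms add up to
  \<open>l * k * l * (l - 1) / 2\<close>, which vanishes for odd \<open>l\<close>. For
  \<open>l = 2\<close> the sum is \<open>1 + a\<close>, whence the condition modulo
  \<open>4\<close>. So the sum contains the factor \<open>l\<close> exactly once.\<close>

lemma geometric_sum_prime_cong:
  fixes a :: int and l :: nat
  assumes "prime l" and "[a = 1] (mod int l)" and "l = 2 \<Longrightarrow> [a = 1] (mod 4)"
  shows "[(\<Sum>i<l. a ^ i) = int l] (mod (int l)\<^sup>2)"
proof (cases "l = 2")
  case True
  with assms(3) show ?thesis
    by (simp add: numeral_2_eq_2 cong_def) presburger
next
  case False
  hence odd: "odd l" using assms(1) by (metis primes_dvd_imp_eq two_is_prime_nat)
  obtain k where k: "a = 1 + int l * k"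
  proof -
    have "int l dvd a - 1" using assms(2) by (simp add: cong_iff_dvd_diff)
    then obtain k where "a - 1 = int l * k" by (elim dvdE)
    thus ?thesis using that[of k] by simp
  qed
  obtain h where h: "l = 2 * h + 1" using odd by (elim oddE)
  have "2 * (\<Sum>i<l. int i) = int l * (int l - 1)"
    by (induction l) (auto simp: algebra_simps)
  hence sum_int: "(\<Sum>i<l. int i) = int l * int h" by (simp add: h)
  have "[(\<Sum>i<l. a ^ i) = (\<Sum>i<l. 1 + int i * (int l * k))] (mod (int l)\<^sup>2)"
    unfolding k by (rule cong_sum) (rule one_plus_mult_power_cong)
  also have "(\<Sum>i<l. 1 + int i * (int l * k)) = int l + (\<Sum>i<l. int i) * (int l * k)"
    by (simp add: sum.distrib sum_distrib_right)
  also have "int l + (\<Sum>i<l. int i) * (int l * k) = int l + (int h * k) * (int l)\<^sup>2"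
    by (simp add: sum_int power2_eq_square algebra_simps)
  also have "[\<dots> = int l] (mod (int l)\<^sup>2)" by (simp add: cong_def)
  finally show ?thesis .
qed

text \<open>The divisibility behind the Hull--Dobell criterion for full-period linear congruential maps.\<close>

lemma dvd_geometric_sum_imp_dvd:
  fixes a :: int and d t :: nat
  assumes "d > 0" and "\<And>l. prime l \<Longrightarrow> l dvd d \<Longrightarrow> [a = 1] (mod int l)"
    and "4 dvd d \<Longrightarrow> [a = 1] (mod 4)"
    and "int d dvd (\<Sum>i<t. a ^ i)"
  shows "d dvd t"
  using assms
proof (induction d arbitrary: a t rule: less_induct)
  case (less d a t)
  show ?case
  proof (cases "d = 1")
    case False
    then obtain l where l: "prime l" "l dvd d" using prime_factor_nat by blast
    obtain e where d: "d = l * e" using l(2) by (elim dvdE)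
    have e: "e > 0" "e < d" using less.prems(1) prime_gt_1_nat[OF l(1)] by (auto simp: d)
    have al: "[a = 1] (mod int l)" using less.prems(2) l by blast
    have "int l dvd (\<Sum>i<t. a ^ i)" using less.prems(4) by (simp add: d) (meson dvd_mult_left)
    with cong_geometric_sum[OF al, of t] have "int l dvd int t"
      by (simp add: cong_dvd_iff)
    then obtain s where t: "t = l * s" by auto
    have "int l dvd (\<Sum>i<l. a ^ i)"
      using cong_geometric_sum[OF al, of l] by (simp add: cong_dvd_iff)
    then obtain u where u: "(\<Sum>i<l. a ^ i) = int l * u" by (elim dvdE)
    \<comment> \<open>A common prime of \<open>e\<close> and \<open>u\<close> divides
      \<open>l\<close>, hence equals \<open>l\<close>, and then the sum of length \<open>l\<close>
      would be divisible by \<open>l\<^sup>2\<close>. So \<open>e\<close> must divide the geometric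
      sum of \<open>a ^ l\<close>, to which induction applies.\<close>
    have "coprime (int e) u"
    proof (rule ccontr)
      assume "\<not> coprime (int e) u"
      then obtain m where m: "prime m" "m dvd int e" "m dvd u"
        using e(1) prime_divisor_exists[of "gcd (int e) u"] by (auto simp: coprime_iff_gcd_eq_1)
      have m0: "m > 0" using m(1) by (rule prime_gt_0_int)
      define m' where "m' = nat m"
      have mm: "m = int m'" using m0 by (simp add: m'_def)
      have m': "prime m'" "m' dvd e" "int m' dvd u" using m unfolding mm by auto
      hence am: "[a = 1] (mod int m')" using less.prems(2)[of m'] by (simp add: d)
      have "int m' dvd int l * u" using m' by simp
      hence "int m' dvd int l" using cong_geometric_sum[OF am, of l] unfolding u by (simp add: cong_dvd_iff)
      hence ml: "m' = l" using m' l by (simp add: primes_dvd_imp_eq)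
      \<comment> \<open>If \<open>l = 2\<close>, then \<open>l dvd e\<close> gives
        \<open>4 dvd d\<close>, which supplies the congruence modulo \<open>4\<close>.\<close>
      hence "[(\<Sum>i<l. a ^ i) = int l] (mod (int l)\<^sup>2)"
        using m'(2) less.prems(3) by (intro geometric_sum_prime_cong l al) (auto simp: d)
      moreover have "(int l)\<^sup>2 dvd int l * u" using m'(3) ml by (simp add: power2_eq_square)
      ultimately have "(int l)\<^sup>2 dvd int l" unfolding u by (simp add: cong_dvd_iff)
      thus False using prime_gt_1_nat[OF l(1)] by (simp add: power2_eq_square)
    qed
    moreover have "int e dvd u * (\<Sum>j<s. (a ^ l) ^ j)"
      using less.prems(4) prime_gt_0_nat[OF l(1)] unfolding t geometric_sum_mult u d by (simp add: mult.assoc)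
    ultimately have "int e dvd (\<Sum>j<s. (a ^ l) ^ j)"
      by (simp add: coprime_dvd_mult_right_iff)
    moreover have "[a ^ l = 1] (mod int k)" if "prime k" "k dvd e" for k
      using cong_pow[OF less.prems(2)[of k], of l] that by (simp add: d)
    moreover have "[a ^ l = 1] (mod 4)" if "4 dvd e"
      using cong_pow[OF less.prems(3), of l] that by (simp add: d)
    ultimately have "e dvd s" using e by (intro less.IH) auto
    thus ?thesis by (simp add: d t)
  qed simp
qed

section \<open>Exponent sets modulo their smallest period\<close>

text \<open>
  \<open>S\<close> is the set of exponents of the connection set; the assumption \<open>same_orbit\<close> says that the
  exponent maps preserving \<open>S\<close> are transitive on \<open>S\<close> and on its complement.
\<close>

locale semilinear_two_orbits =
  fixes p n r :: nat and S :: "int set"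
  assumes prime: "prime p" and r_pos: "r > 0" and n_eq: "n = p ^ r - 1"
    and periodic: "z + int n \<in> S \<longleftrightarrow> z \<in> S"
    and nonempty: "S \<noteq> {}" and nonfull: "S \<noteq> UNIV"
    and same_orbit: "(x \<in> S \<longleftrightarrow> y \<in> S) \<Longrightarrow>
      \<exists>c i. (\<forall>z. int p ^ i * z + c \<in> S \<longleftrightarrow> z \<in> S) \<and> int p ^ i * x + c = y"
begin

text \<open>In terms of a generator \<open>\<omega>\<close>, the pair \<open>(c, i)\<close> stands
  for the semilinear map \<open>x \<mapsto> \<omega> powi c * x ^ (p ^ i)\<close> preserving the
  connection set.\<close>

definition syms :: "(int \<times> nat) set"
  where "syms = {(c, i). \<forall>z. int p ^ i * z + c \<in> S \<longleftrightarrow> z \<in> S}"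

definition d :: nat
  where "d = (LEAST e. e > 0 \<and> (\<forall>z. z + int e \<in> S \<longleftrightarrow> z \<in> S))"

definition i0 :: nat
  where "i0 = (LEAST i. i > 0 \<and> (\<exists>c. (c, i) \<in> syms))"

definition c0 :: int
  where "c0 = (SOME c. (c, i0) \<in> syms)"

definition a :: int
  where "a = int p ^ i0"

text \<open>The closed form of the \<open>t\<close>-fold iterate of
  \<open>z \<mapsto> a * z + c0\<close>; it turns questions about cycle lengths into divisibility of
  geometric sums.\<close>

definition iter :: "nat \<Rightarrow> int \<Rightarrow> int"
  where "iter t z = a ^ t * z + c0 * (\<Sum>i<t. a ^ i)"

lemma int_n: "int n = int p ^ r - 1"
  using prime_gt_0_nat[OF prime] by (simp add: n_eq of_nat_diff)

lemma n_pos: "n > 0"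
proof -
  have "p ^ r > 1" using prime_gt_1_nat[OF prime] r_pos by (rule one_less_power)
  thus ?thesis by (simp add: n_eq)
qed

lemma period_multiple:
  assumes "\<And>z. z + e \<in> S \<longleftrightarrow> z \<in> S"
  shows "z + k * e \<in> S \<longleftrightarrow> z \<in> S"
proof -
  have nat: "z + int m * e \<in> S \<longleftrightarrow> z \<in> S" for m z
  proof (induction m)
    case (Suc m)
    have "z + int (Suc m) * e = (z + int m * e) + e" by (simp add: algebra_simps)
    thus ?case using assms Suc by metis
  qed simp
  show ?thesis
  proof (cases "k \<ge> 0")
    case True thus ?thesis using nat[of z "nat k"] by simp
  next
    case False thus ?thesis using nat[of "z + k * e" "nat (- k)"] by simp
  qed
qed

lemma d_pos: "d > 0" and d_period: "z + int d \<in> S \<longleftrightarrow> z \<in> S"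
proof -
  have "\<exists>e. e > 0 \<and> (\<forall>z. z + int e \<in> S \<longleftrightarrow> z \<in> S)"
    using n_pos periodic by blast
  from LeastI_ex[OF this] show "d > 0" "z + int d \<in> S \<longleftrightarrow> z \<in> S"
    unfolding d_def by auto
qed

lemma mem_cong: "[x = y] (mod int d) \<Longrightarrow> x \<in> S \<longleftrightarrow> y \<in> S"
  using period_multiple[of "int d" y "(x - y) div int d"] d_period
  by (auto simp: cong_iff_dvd_diff)

text \<open>The remainder of \<open>e\<close> modulo \<open>d\<close> is again a period, and a
  nonzero one would undercut the minimality of \<open>d\<close>.\<close>

lemma d_dvd_period:
  assumes "\<And>z. z + e \<in> S \<longleftrightarrow> z \<in> S"
  shows "int d dvd e"
proof (rule ccontr)
  assume "\<not> int d dvd e"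
  define s where "s = nat (e mod int d)"
  have s: "int s = e mod int d" "s > 0" "s < d"
    using \<open>\<not> int d dvd e\<close> d_pos pos_mod_bound[of "int d" e] pos_mod_sign[of "int d" e]
    by (auto simp: s_def dvd_eq_mod_eq_0 nat_less_iff order.order_iff_strict)
  have "z + int s \<in> S \<longleftrightarrow> z \<in> S" for z
  proof -
    have "[z + int s = z + e] (mod int d)" by (simp add: s(1) cong_def mod_simps)
    thus ?thesis using mem_cong assms by blast
  qed
  hence "d \<le> s" unfolding d_def using s(2) by (intro Least_le) auto
  thus False using s(3) by simp
qed

lemma d_dvd_n: "d dvd n"
  using d_dvd_period[of "int n"] periodic by simp

text \<open>A common divisor of \<open>n = p ^ r - 1\<close> and \<open>p\<close> divides
  \<open>1\<close>, and \<open>d\<close> divides \<open>n\<close>. Hence powers of \<open>a\<close>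
  are invertible modulo \<open>d\<close>.\<close>

lemma coprime_p_d: "coprime (int p) (int d)"
proof -
  have "coprime (int n) (int p)"
  proof (rule coprimeI)
    fix c :: int assume "c dvd int n" "c dvd int p"
    moreover have "int p dvd int p ^ r" using r_pos by (intro dvd_power) simp
    ultimately have "c dvd int p ^ r - int n" by (meson dvd_diff dvd_trans)
    thus "is_unit c" by (simp add: int_n)
  qed
  thus ?thesis using d_dvd_n by (metis coprime_commute coprime_divisors dvd_refl int_dvd_int_iff)
qed

text \<open>Raising to the power \<open>p ^ r\<close> is the identity on the field; as a symmetry it
  ensures that \<open>i0\<close> and \<open>c0\<close> exist.\<close>

lemma zero_r_sym: "(0, r) \<in> syms"
proof -
  have "int p ^ r * z = z + z * int n" for z by (simp add: int_n algebra_simps)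
  thus ?thesis using period_multiple[of "int n"] periodic by (auto simp: syms_def)
qed

lemma i0_pos: "i0 > 0" and c0_i0_sym: "(c0, i0) \<in> syms"
proof -
  have "\<exists>i>0. \<exists>c. (c, i) \<in> syms" using zero_r_sym r_pos by blast
  from LeastI_ex[OF this] have *: "i0 > 0" "\<exists>c. (c, i0) \<in> syms" unfolding i0_def by auto
  show "i0 > 0" by fact
  show "(c0, i0) \<in> syms" unfolding c0_def by (rule someI_ex) fact
qed

lemma iter_0: "iter 0 z = z"
  by (simp add: iter_def)

lemma iter_Suc: "iter (Suc t) z = a * iter t z + c0"
proof -
  have "(\<Sum>i<Suc t. a ^ i) = 1 + a * (\<Sum>i<t. a ^ i)"
    by (simp add: sum.lessThan_Suc_shift sum_distrib_left del: sum.lessThan_Suc)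
  thus ?thesis by (simp add: iter_def algebra_simps)
qed

lemma iter_mem: "iter t z \<in> S \<longleftrightarrow> z \<in> S"
  using c0_i0_sym by (induction t) (auto simp: iter_0 iter_Suc syms_def a_def)

text \<open>
  Divide \<open>i\<close> by \<open>i0\<close>; by minimality of \<open>i0\<close> the remainder is \<open>0\<close>, so what is left is a
  translation, hence by a multiple of \<open>d\<close>.
\<close>

lemma sym_eq_iter:
  assumes "(c, i) \<in> syms"
  shows "\<exists>t. \<forall>z. [int p ^ i * z + c = iter t z] (mod int d)"
proof -
  define t s where "t = i div i0" and "s = i mod i0"
  define C where "C = c0 * (\<Sum>i<t. a ^ i)"
  have i: "int p ^ i = a ^ t * int p ^ s"
    by (simp add: a_def t_def s_def power_mult[symmetric] power_add[symmetric])
  have "coprime (a ^ t) (int d)" using coprime_p_d by (simp add: a_def)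
  then obtain b where b: "[a ^ t * b = 1] (mod int d)"
    by (metis cong_solve_coprime_int)
  \<comment> \<open>\<open>b\<close> inverts \<open>a ^ t\<close> modulo \<open>d\<close>;
    \<open>c'\<close> is chosen so that the exponent map of \<open>(c', s)\<close> followed by
    \<open>iter t\<close> is that of \<open>(c, i)\<close>.\<close>
  define c' where "c' = b * (c - C)"
  have c': "[a ^ t * c' + C = c] (mod int d)"
  proof -
    have "[a ^ t * b * (c - C) + C = 1 * (c - C) + C] (mod int d)"
      by (intro cong_add cong_mult b cong_refl)
    thus ?thesis by (simp add: c'_def mult.assoc)
  qed
  have key: "[iter t (int p ^ s * z + c') = int p ^ i * z + c] (mod int d)" for z
  proof -
    have "iter t (int p ^ s * z + c') = int p ^ i * z + (a ^ t * c' + C)"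
      by (simp add: iter_def i C_def algebra_simps)
    also have "[\<dots> = int p ^ i * z + c] (mod int d)" by (intro cong_add cong_refl c')
    finally show ?thesis .
  qed
  have syms: "(c', s) \<in> syms"
    using mem_cong[OF key] iter_mem assms by (auto simp: syms_def)
  have "s = 0"
  proof (rule ccontr)
    assume "s \<noteq> 0"
    hence "i0 \<le> s" unfolding i0_def using syms by (intro Least_le) auto
    thus False using mod_less_divisor[OF i0_pos, of i] by (simp add: s_def)
  qed
  with syms have "int d dvd c'" by (intro d_dvd_period) (auto simp: syms_def)
  hence "[z + c' = z + 0] (mod int d)" for z
    by (intro cong_add cong_refl) (simp add: cong_0_iff)
  hence "[iter t (z + c') = iter t z] (mod int d)" for z
    unfolding iter_def by (intro cong_add cong_mult cong_refl) simp
  thus ?thesis using key \<open>s = 0\<close> by (intro exI[of _ t]) (auto intro: cong_trans[OF cong_sym])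
qed

lemma iter_transitive:
  assumes "x \<in> S \<longleftrightarrow> y \<in> S"
  shows "\<exists>t. [y = iter t x] (mod int d)"
  using same_orbit[OF assms] sym_eq_iter by (fastforce simp: syms_def)

text \<open>The iterates are transitive modulo \<open>d\<close> on \<open>S\<close> and on
  \<open>- S\<close>, so an invariant union of residue classes contains each of the two sets as soon
  as it meets it.\<close>

lemma invariant_set:
  assumes inv: "\<And>z. z \<in> X \<Longrightarrow> a * z + c0 \<in> X"
    and per: "\<And>x y. [x = y] (mod int d) \<Longrightarrow> x \<in> X \<Longrightarrow> y \<in> X"
    and "X \<noteq> {}" "X \<noteq> UNIV"
  shows "S = X \<or> - S = X"
proof -
  have iter_X: "iter t x \<in> X" if "x \<in> X" for t x
    using that inv by (induction t) (auto simp: iter_0 iter_Suc)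
  have closed: "y \<in> X" if "x \<in> X" "x \<in> S \<longleftrightarrow> y \<in> S" for x y
    using iter_transitive[OF that(2)] per iter_X[OF that(1)] cong_sym by blast
  show ?thesis using closed assms(3,4) by blast
qed

end

section \<open>Invariant residue classes and possible cycle structures\<close>

lemma ord_eq_if_powers_cover:
  fixes l p :: nat
  assumes "prime l" and "coprime l p"
    and "\<And>y. \<not> l dvd y \<Longrightarrow> \<exists>k. [y = p ^ k] (mod l)"
  shows "ord l p = l - 1"
proof -
  \<comment> \<open>Powers of \<open>p\<close> depend only on the exponent modulo
    \<open>ord l p\<close>, so covering the \<open>l - 1\<close> nonzero residues bounds the order
    from below; the totient gives the other bound.\<close>
  have "{1..<l} \<subseteq> (\<lambda>k. p ^ k mod l) ` {..<ord l p}"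
  proof
    fix y assume y: "y \<in> {1..<l}"
    hence "\<not> l dvd y" by (auto dest: dvd_imp_le)
    then obtain k where "[y = p ^ k] (mod l)" using assms(3) by blast
    also have "[p ^ k = p ^ (k mod ord l p)] (mod l)"
      using assms(2) by (subst order_divides_expdiff) auto
    finally have "y = p ^ (k mod ord l p) mod l" using y by (simp add: cong_def)
    moreover have "k mod ord l p < ord l p"
      using assms(2) by (intro mod_less_divisor) (metis gr0I ord_eq_0)
    ultimately show "y \<in> (\<lambda>k. p ^ k mod l) ` {..<ord l p}" by blast
  qed
  hence "l - 1 \<le> ord l p" using surj_card_le[of "{..<ord l p}" "{1..<l}"] by simp
  moreover have "ord l p \<le> l - 1"
    using order_divides_totient[OF assms(2)] prime_gt_1_nat[OF assms(1)]
    by (simp add: totient_prime[OF assms(1)] dvd_imp_le)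
  ultimately show ?thesis by simp
qed

context semilinear_two_orbits
begin

lemma coprime_p_dvd_d: "int m dvd int d \<Longrightarrow> coprime (int m) (int p)"
  using coprime_p_d by (metis coprime_commute coprime_divisors dvd_refl)

text \<open>Since \<open>a - 1\<close> is invertible modulo \<open>m\<close>, there is exactly one
  fixed residue; its class is invariant and hence \<open>S\<close> or \<open>- S\<close>. All other
  points then form one orbit, on which an iterate multiplies the difference from the fixed residue
  by a power of \<open>a\<close>; so powers of \<open>p\<close> cover all nonzero residues.\<close>

lemma odd_prime_moved:
  assumes m: "prime m" "m dvd d" and "\<not> [a = 1] (mod int m)"
  shows "\<exists>z0. ord m p = m - 1 \<and> (S = {z. int m dvd z - z0} \<or> - S = {z. int m dvd z - z0})"
proof -
  have md: "int m dvd int d" using m by simp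
  have cong_m: "[x = y] (mod int m)" if "[x = y] (mod int d)" for x y
    using that md by (metis cong_iff_dvd_diff dvd_trans)
  have "\<not> int m dvd a - 1" using assms(3) by (simp add: cong_iff_dvd_diff)
  hence "coprime (a - 1) (int m)"
    using m(1) by (metis coprime_commute prime_imp_coprime prime_nat_int_transfer)
  then obtain b where b: "[(a - 1) * b = 1] (mod int m)" by (metis cong_solve_coprime_int)
  define z0 where "z0 = - (b * c0)"  \<comment> \<open>the fixed point of \<open>z \<mapsto> a * z + c0\<close> modulo \<open>m\<close>\<close>
  define X where "X = {z. int m dvd z - z0}"
  have "[(a - 1) * b * (- c0) + c0 = 1 * (- c0) + c0] (mod int m)"
    by (intro cong_add cong_mult b cong_refl)
  hence fix0: "int m dvd (a - 1) * z0 + c0" by (simp add: z0_def cong_0_iff mult.assoc)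
  have step: "[a * z + c0 - z0 = a * (z - z0)] (mod int m)" for z
  proof -
    have "a * z + c0 - z0 - a * (z - z0) = (a - 1) * z0 + c0" by (simp add: algebra_simps)
    thus ?thesis using fix0 by (simp only: cong_iff_dvd_diff)
  qed
  have SX: "S = X \<or> - S = X"
  proof (rule invariant_set)
    fix z assume "z \<in> X" thus "a * z + c0 \<in> X"
      using cong_dvd_iff[OF step[of z]] by (simp add: X_def)
  next
    fix x y assume "[x = y] (mod int d)" "x \<in> X"
    thus "y \<in> X" using cong_dvd_iff[OF cong_diff[OF cong_m[of x y] cong_refl[of z0]]]
      by (simp add: X_def)
  next
    show "X \<noteq> {}" by (auto simp: X_def intro: exI[of _ z0])
    have "z0 + 1 \<notin> X" using prime_gt_1_nat[OF m(1)] by (simp add: X_def)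
    thus "X \<noteq> UNIV" by blast
  qed
  have iter: "[iter t z - z0 = a ^ t * (z - z0)] (mod int m)" for t z
  proof (induction t)
    case (Suc t)
    have "[a * iter t z + c0 - z0 = a * (iter t z - z0)] (mod int m)" by (rule step)
    also have "[a * (iter t z - z0) = a * (a ^ t * (z - z0))] (mod int m)"
      by (intro cong_mult Suc cong_refl)
    finally show ?case by (simp add: iter_Suc mult.assoc)
  qed (simp add: iter_0)
  have "ord m p = m - 1"
  proof (rule ord_eq_if_powers_cover)
    show "prime m" by fact
    show "coprime m p" using coprime_p_dvd_d[OF md] by simp
    fix y assume "\<not> m dvd y"
    hence "z0 + int y \<notin> X" by (simp add: X_def)
    moreover have "z0 + 1 \<notin> X" using prime_gt_1_nat[OF m(1)] by (simp add: X_def)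
    ultimately obtain t where "[z0 + int y = iter t (z0 + 1)] (mod int d)"
      using SX iter_transitive[of "z0 + 1" "z0 + int y"] by blast
    hence "[z0 + int y - z0 = iter t (z0 + 1) - z0] (mod int m)"
      by (intro cong_diff cong_refl cong_m)
    also have "[iter t (z0 + 1) - z0 = a ^ t] (mod int m)" using iter[of t "z0 + 1"] by simp
    finally have "[int y = int (p ^ (i0 * t))] (mod int m)" by (simp add: a_def power_mult)
    thus "\<exists>k. [y = p ^ k] (mod m)" by (metis cong_int_iff)
  qed
  thus ?thesis using SX unfolding X_def by blast
qed

text \<open>Every residue class modulo \<open>m\<close> is invariant, so each is \<open>S\<close> or
  \<open>- S\<close>. The points \<open>0\<close>, \<open>1\<close>, \<open>2\<close> would then lie
  pairwise on different sides, although there are only two sides.\<close>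

lemma odd_prime_not_fixed:
  assumes "m > 2" "m dvd d" "[a = 1] (mod int m)" "int m dvd c0"
  shows False
proof -
  have inv: "S = {z. int m dvd z - j} \<or> - S = {z. int m dvd z - j}" for j
  proof (rule invariant_set)
    fix z assume z: "z \<in> {z. int m dvd z - j}"
    have "[a * z + c0 - j = 1 * z + 0 - j] (mod int m)"
      using assms(3,4) by (intro cong_diff cong_add cong_mult cong_refl) (auto simp: cong_0_iff)
    thus "a * z + c0 \<in> {z. int m dvd z - j}" using z by (simp add: cong_dvd_iff)
  next
    fix x y assume xy: "[x = y] (mod int d)" "x \<in> {z. int m dvd z - j}"
    have "int m dvd x - y" using xy(1) assms(2)
      by (metis cong_iff_dvd_diff dvd_trans int_dvd_int_iff)
    thus "y \<in> {z. int m dvd z - j}" using xy(2) dvd_diff[of "int m" "x - j" "x - y"] by simp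
  next
    show "{z. int m dvd z - j} \<noteq> {}" by (auto intro: exI[of _ j])
    have "j + 1 \<notin> {z. int m dvd z - j}" using assms(1) by simp
    thus "{z. int m dvd z - j} \<noteq> UNIV" by blast
  qed
  have ndvd: "\<not> int m dvd 1" "\<not> int m dvd 2" using assms(1) by (auto dest: zdvd_imp_le)
  have "(0 \<in> S) \<noteq> (1 \<in> S)" using inv[of 0] ndvd by auto
  moreover have "(0 \<in> S) \<noteq> (2 \<in> S)" using inv[of 0] ndvd by auto
  moreover have "(1 \<in> S) \<noteq> (2 \<in> S)"
  proof -
    have "(2::int) - 1 = 1" by simp
    thus ?thesis using inv[of 1] ndvd(1) by (metis (mono_tags, lifting) Compl_iff diff_self dvd_0_right mem_Collect_eq)
  qed
  ultimately show False by blast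
qed

lemma odd_a_if_even_d: "2 dvd d \<Longrightarrow> odd a"
  using coprime_p_dvd_d[of 2] by (simp add: a_def)

text \<open>The even numbers are invariant. The conclusion copies the shape of
  \<open>odd_prime_moved\<close> with \<open>m = 2\<close>, so both feed the same alternative of the
  classification; here squares are separated from nonsquares.\<close>

lemma even_case:
  assumes "2 dvd d" "even c0"
  shows "\<exists>z0. ord 2 p = 2 - 1 \<and> (S = {z. int 2 dvd z - z0} \<or> - S = {z. int 2 dvd z - z0})"
proof -
  have "S = {z. int 2 dvd z - 0} \<or> - S = {z. int 2 dvd z - 0}"
  proof (rule invariant_set)
    fix x y assume "[x = y] (mod int d)" "x \<in> {z. int 2 dvd z - 0}"
    moreover from this have "2 dvd x - y" using assms(1)
      by (metis cong_iff_dvd_diff dvd_trans int_dvd_int_iff of_nat_numeral)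
    ultimately show "y \<in> {z. int 2 dvd z - 0}" by simp
  next
    have "1 \<notin> {z. int 2 dvd z - 0}" by simp
    thus "{z. int 2 dvd z - 0} \<noteq> UNIV" by blast
  qed (use assms in \<open>auto intro: exI[of _ 0]\<close>)
  moreover have "ord 2 p = 2 - 1"
  proof (rule ord_eq_if_powers_cover)
    show "coprime 2 p" using coprime_p_dvd_d[of 2] assms(1) by simp
    fix y :: nat assume "\<not> 2 dvd y"
    hence "[y = p ^ 0] (mod 2)" by (simp add: cong_def odd_iff_mod_2_eq_one)
    thus "\<exists>k. [y = p ^ k] (mod 2)" by blast
  qed simp
  ultimately show ?thesis by blast
qed

text \<open>Modulo \<open>4\<close> the map is the reflection \<open>z \<mapsto> c0 - z\<close>. For
  odd \<open>c0\<close> it swaps the residues in two pairs of cyclic neighbours, and each pair is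
  invariant.\<close>

lemma mod_four_case:
  assumes "4 dvd d" "a mod 4 = 3" "odd c0"
  shows "\<exists>j. S = {z. (z - j) mod 4 \<in> {0, 1}}"
proof -
  \<comment> \<open>The pair is \<open>{0, 1}\<close> for \<open>c0 mod 4 = 1\<close> and
    \<open>{3, 0}\<close> for \<open>c0 mod 4 = 3\<close>; \<open>j\<close> is its first element in
    cyclic order.\<close>
  define j :: int where "j = (if c0 mod 4 = 1 then 0 else 3)"
  define X where "X = {z :: int. (z - j) mod 4 \<in> {0, 1}}"
  have c0: "c0 mod 4 = 1 \<or> c0 mod 4 = 3" using assms(3) by presburger
  have "S = X \<or> - S = X"
  proof (rule invariant_set)
    fix z assume z: "z \<in> X"
    have "[a * z + c0 - j = 3 * z + c0 - j] (mod 4)"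
      using assms(2) by (intro cong_diff cong_add cong_mult cong_refl) (simp add: cong_def)
    hence "(a * z + c0 - j) mod 4 = (3 * z + c0 - j) mod 4" by (simp add: cong_def)
    moreover have "(3 * z + c0 - j) mod 4 \<in> {0, 1}"
      using z c0 unfolding X_def j_def by (simp split: if_splits) presburger+
    ultimately show "a * z + c0 \<in> X" by (simp add: X_def)
  next
    fix x y assume xy: "[x = y] (mod int d)" "x \<in> X"
    have "[x = y] (mod 4)" using xy(1) assms(1)
      by (metis cong_iff_dvd_diff dvd_trans int_dvd_int_iff of_nat_numeral)
    hence "[x - j = y - j] (mod 4)" by (intro cong_diff cong_refl)
    thus "y \<in> X" using xy(2) by (simp add: X_def cong_def)
  next
    have "j \<in> X" by (simp add: X_def)
    thus "X \<noteq> {}" by blast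
    have "j + 2 \<notin> X" by (simp add: X_def)
    thus "X \<noteq> UNIV" by blast
  qed
  thus ?thesis
  proof
    \<comment> \<open>The complement of a pair is the pair shifted by \<open>2\<close>, so both
      alternatives have the same form.\<close>
    assume "- S = X"
    hence mem: "z \<in> S \<longleftrightarrow> (z - j) mod 4 \<notin> {0, 1}" for z
      unfolding X_def by (metis (mono_tags, lifting) Compl_iff mem_Collect_eq)
    have "w mod 4 \<notin> {0, 1} \<longleftrightarrow> (w - 2) mod 4 \<in> {0, 1}" for w :: int
      by simp presburger
    hence "z \<in> S \<longleftrightarrow> (z - (j + 2)) mod 4 \<in> {0, 1}" for z
      unfolding mem by (metis diff_diff_eq)
    hence "S = {z. (z - (j + 2)) mod 4 \<in> {0, 1}}" by (simp add: set_eq_iff)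
    thus ?thesis by (rule exI)
  next
    assume "S = X"
    thus ?thesis unfolding X_def by (rule exI)
  qed
qed

text \<open>Under the Hull--Dobell conditions the orbit of \<open>0\<close> meets all
  \<open>d\<close> residues, which would make \<open>S\<close> empty or everything.\<close>

lemma not_full_cycle:
  assumes "\<And>l. prime l \<Longrightarrow> l dvd d \<Longrightarrow> [a = 1] (mod int l) \<and> \<not> int l dvd c0"
    and "4 dvd d \<Longrightarrow> [a = 1] (mod 4)"
  shows False
proof -
  define h where "h = (\<lambda>t. nat (iter t 0 mod int d))"
  have int_h: "int (h t) = iter t 0 mod int d" for t using d_pos by (simp add: h_def)
  have cop: "coprime c0 (int d)"
  proof (rule ccontr)
    assume "\<not> coprime c0 (int d)"
    then obtain l where l: "prime l" "l dvd c0" "l dvd int d"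
      using d_pos prime_divisor_exists[of "gcd c0 (int d)"] by (auto simp: coprime_iff_gcd_eq_1)
    have "l = int (nat l)" using prime_gt_0_int[OF l(1)] by simp
    thus False using l assms(1)[of "nat l"] by (metis int_dvd_int_iff prime_int_nat_transfer)
  qed
  \<comment> \<open>As \<open>c0\<close> and \<open>a\<close> are units modulo \<open>d\<close>, a
    repetition at times \<open>s < t\<close> makes \<open>d\<close> divide the geometric sum of
    length \<open>t - s\<close>, and hence \<open>t - s\<close> itself, which is smaller than
    \<open>d\<close>.\<close>
  have less: "\<not> h s = h t" if "s < t" "t < d" for s t
  proof
    assume "h s = h t"
    hence "[iter s 0 = iter t 0] (mod int d)" using int_h by (metis cong_def)
    hence "int d dvd c0 * ((\<Sum>i<t. a ^ i) - (\<Sum>i<s. a ^ i))"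
      by (simp add: iter_def cong_iff_dvd_diff right_diff_distrib dvd_diff_commute)
    hence "int d dvd (\<Sum>i<t. a ^ i) - (\<Sum>i<s. a ^ i)"
      using cop by (simp add: coprime_dvd_mult_right_iff coprime_commute)
    also have "(\<Sum>i<t. a ^ i) - (\<Sum>i<s. a ^ i) = a ^ s * (\<Sum>i<t - s. a ^ i)"
    proof -
      have "(\<Sum>i<t. a ^ i) = (\<Sum>i<s. a ^ i) + (\<Sum>i=s..<t. a ^ i)"
        using that(1) by (simp add: lessThan_atLeast0 sum.atLeastLessThan_concat)
      moreover have "(\<Sum>i=s..<t. a ^ i) = a ^ s * (\<Sum>i<t - s. a ^ i)"
        using that(1) sum.shift_bounds_nat_ivl[of "\<lambda>i. a ^ i" 0 s "t - s"]
        by (simp add: lessThan_atLeast0 power_add sum_distrib_left mult.commute)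
      ultimately show ?thesis by simp
    qed
    finally have "int d dvd (\<Sum>i<t - s. a ^ i)"
      using coprime_p_d by (simp add: a_def coprime_dvd_mult_right_iff coprime_commute)
    hence "d dvd t - s" using assms by (intro dvd_geometric_sum_imp_dvd[of d a]) (auto simp: d_pos)
    thus False using that by (auto dest: dvd_imp_le)
  qed
  have "inj_on h {..<d}" using less by (intro inj_onI) (metis lessThan_iff linorder_neqE_nat)
  moreover have "h ` {..<d} \<subseteq> {..<d}" using d_pos by (auto simp: h_def nat_less_iff)
  ultimately have surj: "h ` {..<d} = {..<d}" by (simp add: endo_inj_surj)
  have "z \<in> S \<longleftrightarrow> 0 \<in> S" for z
  proof -
    have "nat (z mod int d) \<in> h ` {..<d}" using d_pos surj by (simp add: nat_less_iff)
    then obtain t where "nat (z mod int d) = h t" by blast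
    hence "int (nat (z mod int d)) = int (h t)" by simp
    hence "[z = iter t 0] (mod int d)" using d_pos by (simp add: int_h cong_def)
    thus ?thesis using mem_cong iter_mem by blast
  qed
  thus False using nonempty nonfull by blast
qed

theorem classification:
  "(\<exists>m z0. prime m \<and> m \<noteq> p \<and> ord m p = m - 1 \<and> m dvd n \<and>
      (S = {z. int m dvd z - z0} \<or> - S = {z. int m dvd z - z0})) \<or>
   (4 dvd n \<and> p mod 4 = 3 \<and> (\<exists>j. S = {z. (z - j) mod 4 \<in> {0, 1}}))"
proof -
  have neq_p: "m \<noteq> p" if "prime m" "m dvd d" for m
    using coprime_p_dvd_d[of m] that by auto
  have dvd_n: "m dvd n" if "m dvd d" for m using that d_dvd_n dvd_trans by blast
  \<comment> \<open>If the first four cases fail, the full-cycle conditions hold: for the prime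
    \<open>2\<close> the parity case gives that \<open>c0\<close> is odd, and for
    \<open>4 dvd d\<close> the odd number \<open>a\<close> is \<open>1\<close> or \<open>3\<close>
    modulo \<open>4\<close>.\<close>
  consider (moved) m where "prime m" "m dvd d" "\<not> [a = 1] (mod int m)"
    | (fixed) m where "prime m" "m > 2" "m dvd d" "[a = 1] (mod int m)" "int m dvd c0"
    | (even) "2 dvd d" "even c0"
    | (four) "4 dvd d" "a mod 4 = 3" "odd c0"
    | (cycle) "\<And>l. prime l \<Longrightarrow> l dvd d \<Longrightarrow> [a = 1] (mod int l) \<and> \<not> int l dvd c0"
        "4 dvd d \<Longrightarrow> [a = 1] (mod 4)"
  proof -
    have "thesis" if no: "\<not> (\<exists>m. prime m \<and> m dvd d \<and> \<not> [a = 1] (mod int m))"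
      "\<not> (\<exists>m. prime m \<and> m > 2 \<and> m dvd d \<and> [a = 1] (mod int m) \<and> int m dvd c0)"
      "\<not> (2 dvd d \<and> even c0)" "\<not> (4 dvd d \<and> a mod 4 = 3 \<and> odd c0)"
    proof (rule cycle)
      fix l assume l: "prime l" "l dvd d"
      show "[a = 1] (mod int l) \<and> \<not> int l dvd c0"
        using l no(1-3) prime_ge_2_nat[OF l(1)] by (cases "l = 2") auto
    next
      assume 4: "4 dvd d"
      hence "2 dvd d" by (metis dvd_trans even_numeral)
      hence "odd a" "odd c0" using odd_a_if_even_d no(3) by auto
      hence "a mod 4 = 1" using no(4) 4 by presburger
      thus "[a = 1] (mod 4)" by (simp add: cong_def)
    qed
    thus thesis using moved fixed even four by blast
  qed
  thus ?thesis
  proof cases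
    case moved
    thus ?thesis using odd_prime_moved[of m] neq_p dvd_n by blast
  next
    case fixed
    thus ?thesis using odd_prime_not_fixed by blast
  next
    case even
    thus ?thesis using even_case neq_p[of 2] dvd_n[of 2] two_is_prime_nat by blast
  next
    case four
    \<comment> \<open>\<open>a\<close> is a power of the odd number \<open>p\<close>, so
      \<open>p mod 4 = 1\<close> would force \<open>a mod 4 = 1\<close>.\<close>
    have "p mod 4 = 3"
    proof (rule ccontr)
      assume "p mod 4 \<noteq> 3"
      have "2 dvd d" using four(1) by (metis dvd_trans even_numeral)
      hence "odd p" using coprime_p_dvd_d[of 2] by simp
      hence "p mod 4 = 1" using \<open>p mod 4 \<noteq> 3\<close> by presburger
      hence "[int p = 1] (mod 4)" by (simp add: cong_def) presburger
      hence "[a = 1] (mod 4)" unfolding a_def using cong_pow[of "int p" 1 4 i0] by simp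
      thus False using four(2) by (simp add: cong_def)
    qed
    thus ?thesis using mod_four_case[OF four] dvd_n[OF four(1)] by blast
  next
    case cycle
    thus ?thesis using not_full_cycle by blast
  qed
qed

end

section \<open>Counting in permutation groups\<close>

locale permutation_subgroup =
  fixes G :: "('a::finite \<Rightarrow> 'a) set"
  assumes bij: "g \<in> G \<Longrightarrow> bij g"
    and id_mem: "(\<lambda>x. x) \<in> G"
    and comp_mem: "g \<in> G \<Longrightarrow> h \<in> G \<Longrightarrow> g \<circ> h \<in> G"
    and inv_mem: "g \<in> G \<Longrightarrow> inv_into UNIV g \<in> G"

text \<open>On \<open>UNIV\<close> the restricted composition and inverse of \<open>BijGroup\<close>
  are the plain ones, which lets later arguments compose functions directly.\<close>

lemma subgroup_BijGroup_imp_permutation_subgroup: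
  fixes G :: "('a::finite \<Rightarrow> 'a) set"
  assumes "subgroup G (BijGroup UNIV)"
  shows "permutation_subgroup G"
proof
  have Bij: "g \<in> Bij UNIV" if "g \<in> G" for g
    using subgroup.subset[OF assms] that by (auto simp: BijGroup_def)
  show "bij g" if "g \<in> G" for g using Bij[OF that] by (simp add: Bij_def)
  show "(\<lambda>x. x) \<in> G"
    using subgroup.one_closed[OF assms] by (simp add: BijGroup_def restrict_def)
  show "g \<circ> h \<in> G" if "g \<in> G" "h \<in> G" for g h
  proof -
    have "compose UNIV g h \<in> G"
      using subgroup.m_closed[OF assms that] Bij that by (simp add: BijGroup_def)
    thus ?thesis by (simp add: compose_def restrict_def comp_def)
  qed
  show "inv_into UNIV g \<in> G" if "g \<in> G" for g
    using subgroup.m_inv_closed[OF assms that] inv_BijGroup[OF Bij[OF that]]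
    by (simp add: restrict_def)
qed

text \<open>The fiber of \<open>f\<close> through \<open>h\<close> is the left coset of
  \<open>K\<close> by \<open>h\<close>, so all fibers have \<open>card K\<close> elements.
  Lagrange's theorem, orbit counting and the two kernel computations below are instances.\<close>

lemma card_fibers:
  fixes G K :: "('a::finite \<Rightarrow> 'a) set"
  assumes bij: "\<And>g. g \<in> G \<Longrightarrow> bij g"
    and closed: "\<And>g k. g \<in> G \<Longrightarrow> k \<in> K \<Longrightarrow> g \<circ> k \<in> G"
    and fiber: "\<And>g h. g \<in> G \<Longrightarrow> h \<in> G \<Longrightarrow> f g = f h \<longleftrightarrow> inv_into UNIV h \<circ> g \<in> K"
  shows "card G = card (f ` G) * card K"
proof -
  have "card {g \<in> G. f g = y} = card K" if y: "y \<in> f ` G" for y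
  proof -
    obtain h where h: "h \<in> G" "y = f h" using y by blast
    have "{g \<in> G. f g = y} = (\<lambda>k. h \<circ> k) ` K"
    proof (intro equalityI subsetI)
      fix g assume "g \<in> {g \<in> G. f g = y}"
      hence "inv_into UNIV h \<circ> g \<in> K" using fiber h by blast
      moreover have "g = h \<circ> (inv_into UNIV h \<circ> g)"
        using bij[OF h(1)] by (simp add: fun_eq_iff bij_is_surj surj_f_inv_f)
      ultimately show "g \<in> (\<lambda>k. h \<circ> k) ` K" by (metis imageI)
    next
      fix g assume "g \<in> (\<lambda>k. h \<circ> k) ` K"
      then obtain k where k: "k \<in> K" "g = h \<circ> k" by blast
      have "inv_into UNIV h \<circ> g = k" using bij[OF h(1)] by (simp add: k fun_eq_iff bij_is_inj)
      thus "g \<in> {g \<in> G. f g = y}" using fiber[of g h] closed h k by auto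
    qed
    moreover have "inj_on (\<lambda>k. h \<circ> k) K"
      using bij[OF h(1)] by (intro inj_onI) (auto simp: fun_eq_iff bij_def inj_eq)
    ultimately show ?thesis by (simp add: card_image)
  qed
  moreover have "card G = (\<Sum>y\<in>f ` G. card {g \<in> G. f g = y})"
    using sum.image_gen[of G "\<lambda>_. 1::nat" f] by simp
  ultimately show ?thesis by simp
qed

lemma (in permutation_subgroup) card_subgroup_dvd:
  assumes "permutation_subgroup K" "K \<subseteq> G"
  shows "card K dvd card G"
proof -
  interpret K: permutation_subgroup K by fact
  have "card G = card ((\<lambda>g. (\<lambda>k. g \<circ> k) ` K) ` G) * card K"
  proof (rule card_fibers)
    fix g h assume g: "g \<in> G" and h: "h \<in> G"
    have hg: "h \<circ> (inv_into UNIV h \<circ> g) = g"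
      using bij[OF h] by (simp add: fun_eq_iff bij_is_surj surj_f_inv_f)
    show "(\<lambda>k. g \<circ> k) ` K = (\<lambda>k. h \<circ> k) ` K \<longleftrightarrow> inv_into UNIV h \<circ> g \<in> K"
    proof
      assume "(\<lambda>k. g \<circ> k) ` K = (\<lambda>k. h \<circ> k) ` K"
      moreover have "g \<in> (\<lambda>k. g \<circ> k) ` K" using K.id_mem by (force simp: comp_def)
      ultimately obtain k where k: "k \<in> K" "g = h \<circ> k" by blast
      hence "inv_into UNIV h \<circ> g = k" using bij[OF h] by (simp add: fun_eq_iff bij_is_inj)
      thus "inv_into UNIV h \<circ> g \<in> K" using k by simp
    next
      assume k: "inv_into UNIV h \<circ> g \<in> K"
      define k where "k = inv_into UNIV h \<circ> g"
      have kK: "k \<in> K" using k by (simp add: k_def)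
      have "(\<lambda>j. k \<circ> j) ` K = K"
      proof (intro equalityI subsetI)
        fix j assume j: "j \<in> K"
        have "j = k \<circ> (inv_into UNIV k \<circ> j)"
          using K.bij[OF kK] by (simp add: fun_eq_iff bij_is_surj surj_f_inv_f)
        thus "j \<in> (\<lambda>j. k \<circ> j) ` K"
          using K.comp_mem[OF K.inv_mem[OF kK] j] by (rule image_eqI)
      qed (auto intro: K.comp_mem kK)
      hence "(\<lambda>j. h \<circ> j) ` K = (\<lambda>j. h \<circ> j) ` (\<lambda>j. k \<circ> j) ` K" by simp
      also have "\<dots> = (\<lambda>j. h \<circ> k \<circ> j) ` K" by (simp add: image_image comp_assoc)
      finally show "(\<lambda>k. g \<circ> k) ` K = (\<lambda>k. h \<circ> k) ` K" by (simp add: k_def hg)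
    qed
  qed (use bij comp_mem assms in blast)+
  thus ?thesis by simp
qed

text \<open>Orbit and stabilizer for pairs; with \<open>x = y\<close> it counts the orbit of a
  point.\<close>

lemma (in permutation_subgroup) card_pair_orbit_dvd:
  "card ((\<lambda>g. (g x, g y)) ` G) dvd card G"
proof -
  have "card G = card ((\<lambda>g. (g x, g y)) ` G) * card {k \<in> G. k x = x \<and> k y = y}"
  proof (rule card_fibers)
    fix g h assume gh: "g \<in> G" "h \<in> G"
    have "inv_into UNIV h (g z) = z \<longleftrightarrow> g z = h z" for z
      using bij[OF gh(2)] by (metis bij_inv_eq_iff)
    thus "(g x, g y) = (h x, h y) \<longleftrightarrow> inv_into UNIV h \<circ> g \<in> {k \<in> G. k x = x \<and> k y = y}"
      using comp_mem[OF inv_mem[OF gh(2)] gh(1)] by simp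
  qed (use bij comp_mem in auto)
  thus ?thesis by simp
qed

lemma perm_rank_eq: "perm_rank G = card (range (\<lambda>(x, y). (\<lambda>g. (g x, g y)) ` G))"
proof -
  have "orbit (perm_group G) (\<lambda>g. map_prod g g) z = (\<lambda>(x, y). (\<lambda>g. (g x, g y)) ` G) z" for z
    by (auto simp: orbit_def perm_group_def)
  hence "orbits (perm_group G) (UNIV \<times> UNIV) (\<lambda>g. map_prod g g)
      = range (\<lambda>(x, y). (\<lambda>g. (g x, g y)) ` G)"
    unfolding orbits_def by auto
  thus ?thesis by (simp add: perm_rank_def)
qed

text \<open>The diagonal, \<open>R\<close> and the remaining pairs are nonempty invariant sets, so
  with only three orbits each of them is a single orbit. This serves both for the graph and for the
  relation given by the translations.\<close>

lemma (in permutation_subgroup) rank_three_same_orbit: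
  assumes rank: "perm_rank G = 3"
    and inv: "\<And>g x y. g \<in> G \<Longrightarrow> (g x, g y) \<in> R \<longleftrightarrow> (x, y) \<in> R"
    and "irrefl R" "(a, b) \<in> R" "(c, d) \<notin> R" "c \<noteq> d"
    and xy: "x \<noteq> y" "x' \<noteq> y'" "(x, y) \<in> R \<longleftrightarrow> (x', y') \<in> R"
  shows "\<exists>g\<in>G. g x = x' \<and> g y = y'"
proof -
  define orb where "orb = (\<lambda>(x, y). (\<lambda>g. (g x, g y)) ` G)"
  have self: "z \<in> orb z" for z using id_mem by (force simp: orb_def split: prod.split)
  have orb: "(u, v) \<in> orb (x, y) \<Longrightarrow> ((u, v) \<in> R \<longleftrightarrow> (x, y) \<in> R) \<and> (u = v \<longleftrightarrow> x = y)" for u v x y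
    using inv bij by (auto simp: orb_def bij_def inj_eq)
  have "orb (a, b) \<noteq> orb (c, d)" "orb (a, b) \<noteq> orb (a, a)" "orb (c, d) \<noteq> orb (a, a)"
    using self[of "(a, b)"] self[of "(c, d)"] orb assms(3-6) unfolding irrefl_def by metis+
  hence "card {orb (a, a), orb (a, b), orb (c, d)} = 3" by auto
  hence all: "range orb = {orb (a, a), orb (a, b), orb (c, d)}"
    using rank unfolding perm_rank_eq orb_def[symmetric]
    by (intro card_seteq[symmetric]) auto
  have "orb (u, v) = (if (u, v) \<in> R then orb (a, b) else orb (c, d))" if "u \<noteq> v" for u v
  proof -
    have "orb (u, v) \<in> {orb (a, a), orb (a, b), orb (c, d)}" using all by blast
    then consider "orb (u, v) = orb (a, a)" | "orb (u, v) = orb (a, b)" | "orb (u, v) = orb (c, d)"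
      by blast
    thus ?thesis
    proof cases
      case 1 thus ?thesis using self[of "(u, v)"] orb[of u v a a] that by simp
    next
      case 2 thus ?thesis using self[of "(u, v)"] orb[of u v a b] assms(4) by simp
    next
      case 3 thus ?thesis using self[of "(u, v)"] orb[of u v c d] assms(5) by simp
    qed
  qed
  hence "orb (x, y) = orb (x', y')" using xy by simp
  hence "(x', y') \<in> orb (x, y)" using self by simp
  thus ?thesis by (auto simp: orb_def)
qed

section \<open>Characteristic and powers in a finite field\<close>

lemma CHAR_eq_prime:
  assumes "prime p" "CARD('a::{field,finite}) = p ^ r"
  shows "CHAR('a) = p"
proof -
  have "CHAR('a) > 0" by (rule finite_imp_CHAR_pos) simp
  hence "prime CHAR('a)" by (rule prime_CHAR_semidom)
  moreover have "CHAR('a) dvd p ^ r" using CHAR_dvd_CARD[where ?'a = 'a] assms(2) by simp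
  ultimately show ?thesis using assms(1) prime_dvd_power primes_dvd_imp_eq by metis
qed

text \<open>Multiplication by \<open>x\<close> permutes the nonzero elements; compare the products
  over all of them.\<close>

lemma power_card_minus_1:
  fixes x :: "'a::{field,finite}"
  assumes "x \<noteq> 0"
  shows "x ^ (CARD('a) - 1) = 1"
proof -
  let ?U = "UNIV - {0::'a}"
  have "bij_betw (\<lambda>y. x * y) ?U ?U"
    by (rule bij_betwI[of _ _ _ "\<lambda>y. y / x"]) (use assms in auto)
  hence "(\<Prod>y\<in>?U. x * y) = \<Prod>?U" by (rule prod.reindex_bij_betw)
  hence "x ^ card ?U * \<Prod>?U = \<Prod>?U" by (simp add: prod.distrib)
  moreover have "\<Prod>?U \<noteq> 0" by simp
  ultimately show ?thesis by simp
qed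

lemma power_card:
  fixes x :: "'a::{field,finite}"
  shows "x ^ CARD('a) = x"
proof (cases "x = 0")
  case False
  have "x ^ CARD('a) = x * x ^ (CARD('a) - 1)"
    by (metis finite_UNIV_card_ge_0 finite power_eq_if less_numeral_extra(3))
  thus ?thesis using power_card_minus_1[OF False] by simp
qed simp

section \<open>Linear parts and translations of a rank three group\<close>

definition linear_part :: "('a::ab_group_add \<Rightarrow> 'a) \<Rightarrow> 'a \<Rightarrow> 'a"
  where "linear_part g = (\<lambda>x. g x - g 0)"

lemma permutation_subgroup_translations:
  fixes U :: "'a::{ab_group_add,finite} set"
  assumes "0 \<in> U" "\<And>u v. u \<in> U \<Longrightarrow> v \<in> U \<Longrightarrow> u + v \<in> U" "\<And>u. u \<in> U \<Longrightarrow> - u \<in> U"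
  shows "permutation_subgroup ((\<lambda>v x. x + v) ` U)"
proof
  fix g h :: "'a \<Rightarrow> 'a"
  assume "g \<in> (\<lambda>v x. x + v) ` U"
  then obtain u where u: "u \<in> U" "g = (\<lambda>x. x + u)" by blast
  show "bij g" by (rule bij_betwI[of _ _ _ "\<lambda>x. x - u"]) (auto simp: u)
  have "inv_into UNIV g = (\<lambda>x. x + - u)" by (rule inv_equality) (simp_all add: u)
  thus "inv_into UNIV g \<in> (\<lambda>v x. x + v) ` U" using assms(3) u(1) by blast
  assume "h \<in> (\<lambda>v x. x + v) ` U"
  then obtain v where v: "v \<in> U" "h = (\<lambda>x. x + v)" by blast
  have "g \<circ> h = (\<lambda>x. x + (v + u))" by (simp add: u v fun_eq_iff algebra_simps)
  thus "g \<circ> h \<in> (\<lambda>v x. x + v) ` U" using assms(2) u(1) v(1) by blast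
next
  show "(\<lambda>x. x) \<in> (\<lambda>v x. x + v) ` U" using assms(1) by (intro image_eqI[of _ _ 0]) auto
qed

lemma card_translations: "card ((\<lambda>v x. x + v) ` U) = card (U :: 'a::ab_group_add set)"
  by (rule card_image) (auto simp: inj_on_def fun_eq_iff)

locale affine_rank_three =
  fixes p r :: nat and G :: "('a::{field,finite} \<Rightarrow> 'a) set"
  assumes prime: "prime p" and r_pos: "r > 0" and card_eq: "CARD('a) = p ^ r"
    and affine: "G \<subseteq> AGammaL1 p"
    and group: "subgroup G (BijGroup UNIV)" and rank: "perm_rank G = 3"
    and transitive: "transitive_action (perm_group G) UNIV (\<lambda>g. g)"

sublocale affine_rank_three \<subseteq> permutation_subgroup G
  using group by (rule subgroup_BijGroup_imp_permutation_subgroup)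

context affine_rank_three
begin

definition V :: "'a set"
  where "V = {v. (\<lambda>x. x + v) \<in> G}"

abbreviation H :: "('a \<Rightarrow> 'a) set"
  where "H \<equiv> linear_part ` G"

lemma transitive': "\<exists>g\<in>G. g x = y"
  using transitive_action.unique_orbit[OF transitive, of x y] by (simp add: perm_group_def)

lemma frobenius_add: "(x + y) ^ (p ^ i) = x ^ (p ^ i) + y ^ (p ^ i)" for x y :: 'a
  using freshmans_dream'[where ?'a = 'a, of "p ^ i" i x y] prime CHAR_eq_prime[OF prime card_eq]
  by simp

lemma linear_part_form:
  assumes "g \<in> G"
  shows "\<exists>a i. a \<noteq> 0 \<and> linear_part g = (\<lambda>x. a * x ^ (p ^ i))"
proof -
  obtain a b i where "a \<noteq> 0" "g = (\<lambda>x. a * x ^ (p ^ i) + b)"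
    using assms affine by (auto simp: AGammaL1_def)
  moreover have "p ^ i > 0" using prime_gt_0_nat[OF prime] by simp
  ultimately show ?thesis by (auto simp: linear_part_def zero_power)
qed

lemma apply_add_linear_part:
  assumes "g \<in> G"
  shows "g (x + y) = g x + linear_part g y"
proof -
  obtain a i where "linear_part g = (\<lambda>x. a * x ^ (p ^ i))"
    using linear_part_form[OF assms] by blast
  hence "linear_part g (x + y) = linear_part g x + linear_part g y"
    by (simp add: frobenius_add distrib_left)
  thus ?thesis by (simp add: linear_part_def algebra_simps)
qed

lemma linear_part_comp:
  assumes "g \<in> G" "h \<in> G"
  shows "linear_part (g \<circ> h) = linear_part g \<circ> linear_part h"
proof
  fix x
  have "g (h 0 + linear_part h x) = g (h 0) + linear_part g (linear_part h x)"
    by (rule apply_add_linear_part) fact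
  thus "linear_part (g \<circ> h) x = (linear_part g \<circ> linear_part h) x"
    by (simp add: linear_part_def)
qed

lemma linear_part_id: "linear_part (\<lambda>x. x) = (\<lambda>x::'a. x)"
  by (simp add: linear_part_def)

lemma inv_comp: "g \<in> G \<Longrightarrow> inv_into UNIV g \<circ> g = (\<lambda>x. x)"
  and comp_inv: "g \<in> G \<Longrightarrow> g \<circ> inv_into UNIV g = (\<lambda>x. x)"
  using bij[of g] by (auto simp: fun_eq_iff bij_is_inj bij_is_surj surj_f_inv_f)

lemma bij_linear_part:
  assumes "g \<in> G"
  shows "bij (linear_part g)"
proof (rule o_bij)
  show "linear_part (inv_into UNIV g) \<circ> linear_part g = id"
    using linear_part_comp[OF inv_mem[OF assms] assms]
    by (simp add: inv_comp[OF assms] linear_part_id id_def)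
  show "linear_part g \<circ> linear_part (inv_into UNIV g) = id"
    using linear_part_comp[OF assms inv_mem[OF assms]]
    by (simp add: comp_inv[OF assms] linear_part_id id_def)
qed

lemma inv_linear_part:
  assumes "g \<in> G"
  shows "inv_into UNIV (linear_part g) = linear_part (inv_into UNIV g)"
proof (rule inv_unique_comp)
  show "linear_part (inv_into UNIV g) \<circ> linear_part g = id"
    using linear_part_comp[OF inv_mem[OF assms] assms]
    by (simp add: inv_comp[OF assms] linear_part_id id_def)
  show "linear_part g \<circ> linear_part (inv_into UNIV g) = id"
    using linear_part_comp[OF assms inv_mem[OF assms]]
    by (simp add: comp_inv[OF assms] linear_part_id id_def)
qed

lemma permutation_subgroup_linear_part: "permutation_subgroup H"
proof
  show "(\<lambda>x. x) \<in> H" using linear_part_id id_mem by (metis imageI)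
  show "g \<circ> h \<in> H" if "g \<in> H" "h \<in> H" for g h
    using that comp_mem by (auto simp flip: linear_part_comp)
qed (auto simp: bij_linear_part inv_linear_part inv_mem)

lemma V_zero: "0 \<in> V"
  using id_mem by (simp add: V_def)

lemma V_add: "u \<in> V \<Longrightarrow> v \<in> V \<Longrightarrow> u + v \<in> V"
  using comp_mem[of "\<lambda>x. x + v" "\<lambda>x. x + u"] by (simp add: V_def comp_def add.assoc)

lemma V_uminus:
  assumes "v \<in> V"
  shows "- v \<in> V"
proof -
  have "inv_into UNIV (\<lambda>x. x + v) = (\<lambda>x. x + - v)" by (rule inv_equality) simp_all
  thus ?thesis using inv_mem[of "\<lambda>x. x + v"] assms by (simp add: V_def)
qed

text \<open>The kernel of \<open>linear_part\<close> on \<open>G\<close> consists of the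
  translations in \<open>G\<close>, which are indexed by \<open>V\<close>.\<close>

lemma card_G: "card G = card H * card V"
proof -
  have "card G = card H * card ((\<lambda>v x. x + v) ` V)"
  proof (rule card_fibers)
    fix g h assume gh: "g \<in> G" "h \<in> G"
    show "linear_part g = linear_part h \<longleftrightarrow> inv_into UNIV h \<circ> g \<in> (\<lambda>v x. x + v) ` V"
    proof
      assume eq: "linear_part g = linear_part h"
      define v where "v = inv_into UNIV h (g 0)"
      have hv: "h v = g 0" unfolding v_def using bij[OF gh(2)] by (simp add: bij_is_surj surj_f_inv_f)
      have "inv_into UNIV h (g x) = x + v" for x
      proof -
        have "h (v + x) = g 0 + linear_part g x" using apply_add_linear_part[OF gh(2)] by (simp add: hv eq)
        also have "\<dots> = g x" by (simp add: linear_part_def)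
        finally show ?thesis using bij[OF gh(2)] by (metis add.commute bij_inv_eq_iff)
      qed
      hence "inv_into UNIV h \<circ> g = (\<lambda>x. x + v)" by (simp add: fun_eq_iff)
      thus "inv_into UNIV h \<circ> g \<in> (\<lambda>v x. x + v) ` V"
        using comp_mem[OF inv_mem[OF gh(2)] gh(1)] by (auto simp: V_def)
    next
      assume "inv_into UNIV h \<circ> g \<in> (\<lambda>v x. x + v) ` V"
      then obtain v where v: "inv_into UNIV h \<circ> g = (\<lambda>x. x + v)" by blast
      have "g x = h (v + x)" for x
        using fun_cong[OF v, of x] bij[OF gh(2)] by (simp add: add.commute) (metis bij_inv_eq_iff)
      thus "linear_part g = linear_part h"
        using apply_add_linear_part[OF gh(2), of v] by (simp add: linear_part_def fun_eq_iff)
    qed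
  qed (use bij comp_mem in \<open>auto simp: V_def\<close>)
  thus ?thesis by (simp add: card_translations)
qed

text \<open>Conjugating the translation by \<open>v\<close> with \<open>g\<close> gives the
  translation by \<open>linear_part g v\<close>.\<close>

lemma V_invariant: "g \<in> G \<Longrightarrow> v \<in> V \<Longrightarrow> linear_part g v \<in> V"
proof -
  assume g: "g \<in> G" and v: "v \<in> V"
  have "g \<circ> (\<lambda>x. x + v) \<circ> inv_into UNIV g = (\<lambda>x. x + linear_part g v)"
    using bij[OF g] by (simp add: fun_eq_iff apply_add_linear_part[OF g] bij_is_surj surj_f_inv_f)
  moreover have "g \<circ> (\<lambda>x. x + v) \<circ> inv_into UNIV g \<in> G"
    using v by (intro comp_mem g inv_mem) (simp add: V_def)
  ultimately show ?thesis by (simp add: V_def)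
qed

text \<open>The kernel of the map from linear parts to field automorphisms that sends
  \<open>x \<mapsto> a * x ^ (p ^ i)\<close> to \<open>x \<mapsto> x ^ (p ^ i)\<close>.\<close>

definition M :: "('a \<Rightarrow> 'a) set"
  where "M = H \<inter> range (\<lambda>a x. a * x)"

text \<open>By Lagrange, \<open>card M\<close> divides \<open>p ^ r - 1\<close>, the order of the
  group \<open>L\<close> of multiplications by nonzero elements.\<close>

lemma coprime_card_M: "coprime (p ^ r) (card M)"
proof -
  interpret H: permutation_subgroup H by (rule permutation_subgroup_linear_part)
  define L where "L = (\<lambda>a x. a * x :: 'a) ` (UNIV - {0})"
  have inv_L: "inv_into UNIV (\<lambda>x. a * x) = (\<lambda>x. inverse a * x)" if "a \<noteq> 0" for a :: 'a
    by (rule inv_equality) (simp_all add: that)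
  have bij_L: "bij (\<lambda>x. a * x)" if "a \<noteq> 0" for a :: 'a
    by (rule bij_betwI[of _ _ _ "\<lambda>x. x / a"]) (use that in auto)
  have comp_L: "(\<lambda>x. a * x) \<circ> (\<lambda>x. b * x) = (\<lambda>x. (a * b) * x)" for a b :: 'a
    by (simp add: fun_eq_iff)
  have sub_L: "M \<subseteq> L"
  proof
    fix g assume "g \<in> M"
    then obtain a where a: "g = (\<lambda>x. a * x)" "g \<in> H" unfolding M_def by blast
    have "a \<noteq> 0"
    proof
      assume "a = 0"
      hence "g 0 = g 1" by (simp add: a(1))
      thus False using H.bij[OF a(2)] by (metis bij_def inj_eq zero_neq_one)
    qed
    thus "g \<in> L" unfolding L_def a(1) by blast
  qed
  interpret L: permutation_subgroup L
  proof
    show "(\<lambda>x. x) \<in> L" unfolding L_def by (intro image_eqI[of _ _ 1]) auto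
    show "g \<circ> h \<in> L" if "g \<in> L" "h \<in> L" for g h
      using that unfolding L_def by (auto simp: comp_L)
    show "inv_into UNIV g \<in> L" if "g \<in> L" for g
      using that unfolding L_def by (auto simp: inv_L)
    show "bij g" if "g \<in> L" for g
      using that bij_L unfolding L_def by blast
  qed
  have "permutation_subgroup M"
  proof
    show "bij g" if "g \<in> M" for g using that H.bij by (auto simp: M_def)
    show "(\<lambda>x. x) \<in> M"
    proof -
      have "(\<lambda>x::'a. x) = (\<lambda>x. 1 * x)" by simp
      hence "(\<lambda>x::'a. x) \<in> range (\<lambda>a x. a * x)" by (rule range_eqI)
      thus ?thesis using H.id_mem by (simp add: M_def)
    qed
    show "g \<circ> h \<in> M" if "g \<in> M" "h \<in> M" for g h
    proof -
      obtain a b where "g = (\<lambda>x. a * x)" "h = (\<lambda>x. b * x)" using \<open>g \<in> M\<close> \<open>h \<in> M\<close> unfolding M_def by blast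
      hence "g \<circ> h \<in> range (\<lambda>a x. a * x)" using comp_L by blast
      moreover have "g \<circ> h \<in> H" using that by (intro H.comp_mem) (simp_all add: M_def)
      ultimately show ?thesis by (simp add: M_def)
    qed
    show "inv_into UNIV g \<in> M" if "g \<in> M" for g
    proof -
      have "inv_into UNIV g \<in> L" using that sub_L L.inv_mem by blast
      hence "inv_into UNIV g \<in> range (\<lambda>a x. a * x)" unfolding L_def by blast
      moreover have "inv_into UNIV g \<in> H" using that by (intro H.inv_mem) (simp add: M_def)
      ultimately show ?thesis by (simp add: M_def)
    qed
  qed
  hence "card M dvd card L" using sub_L by (rule L.card_subgroup_dvd)
  also have "card L = card (UNIV - {0::'a})" unfolding L_def
    by (rule card_image) (auto simp: inj_on_def fun_eq_iff dest: spec[of _ 1])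
  also have "\<dots> = p ^ r - 1" by (simp add: card_eq)
  finally have "card M dvd p ^ r - 1" .
  moreover have "coprime (p ^ r - 1) (p ^ r)"
    by (rule coprime_diff_one_left_nat) (simp add: prime_gt_0_nat[OF prime])
  ultimately show ?thesis by (meson coprime_commute coprime_divisors dvd_refl)
qed

text \<open>Normalizing the linear parts to fix \<open>1\<close> maps them to at most \<open>r\<close> field automorphisms; the fibers
  are cosets of \<open>M\<close>.\<close>

lemma not_dvd_card_H: "\<not> p ^ r dvd card H"
proof
  interpret H: permutation_subgroup H by (rule permutation_subgroup_linear_part)
  define f where "f = (\<lambda>(h :: 'a \<Rightarrow> 'a) x. h x / h 1)"
  have form: "\<exists>a i. a \<noteq> 0 \<and> h = (\<lambda>x. a * x ^ (p ^ i))" if "h \<in> H" for h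
    using that linear_part_form by blast
  have "card H = card (f ` H) * card M"
  proof (rule card_fibers)
    fix g h assume gh: "g \<in> H" "h \<in> H"
    obtain a i where g: "a \<noteq> 0" "g = (\<lambda>x. a * x ^ (p ^ i))" using form[OF gh(1)] by blast
    obtain b j where h: "b \<noteq> 0" "h = (\<lambda>x. b * x ^ (p ^ j))" using form[OF gh(2)] by blast
    have bij_h: "bij h" using H.bij gh by blast
    have mem: "inv_into UNIV h \<circ> g \<in> M \<longleftrightarrow> inv_into UNIV h \<circ> g \<in> range (\<lambda>a x. a * x)"
      using H.comp_mem[OF H.inv_mem[OF gh(2)] gh(1)] by (simp add: M_def)
    show "f g = f h \<longleftrightarrow> inv_into UNIV h \<circ> g \<in> M"
    proof
      assume "f g = f h"
      hence eq: "x ^ (p ^ i) = x ^ (p ^ j)" for x :: 'a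
        using g(1) h(1) by (simp add: f_def g(2) h(2) fun_eq_iff)
      define c where "c = inv_into UNIV h a"
      have "h c = a" unfolding c_def using bij_h by (simp add: bij_is_surj surj_f_inv_f)
      hence "g x = h (c * x)" for x by (simp add: g(2) h(2) eq power_mult_distrib mult.assoc[symmetric])
      hence "inv_into UNIV h \<circ> g = (\<lambda>x. c * x)"
        using bij_h by (simp add: fun_eq_iff bij_is_inj)
      thus "inv_into UNIV h \<circ> g \<in> M" unfolding mem by blast
    next
      assume "inv_into UNIV h \<circ> g \<in> M"
      then obtain c where c: "inv_into UNIV h \<circ> g = (\<lambda>x. c * x)" unfolding mem by blast
      have "g x = h (c * x)" for x
        using fun_cong[OF c, of x] bij_h by simp (metis bij_inv_eq_iff)
      hence gx: "a * x ^ (p ^ i) = b * (c ^ (p ^ j) * x ^ (p ^ j))" for x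
        by (simp add: g(2) h(2) power_mult_distrib)
      from gx[of 1] have a: "a = b * c ^ (p ^ j)" by simp
      have "x ^ (p ^ i) = x ^ (p ^ j)" for x :: 'a
      proof -
        have "a * x ^ (p ^ i) = a * x ^ (p ^ j)" using gx[of x] by (simp only: a mult.assoc)
        thus ?thesis using g(1) by simp
      qed
      thus "f g = f h" using g(1) h(1) by (simp add: f_def g(2) h(2) fun_eq_iff)
    qed
  qed (use H.bij H.comp_mem in \<open>auto simp: M_def\<close>)
  moreover assume "p ^ r dvd card H"
  ultimately have "p ^ r dvd card (f ` H)"
    using coprime_card_M by (simp add: coprime_dvd_mult_left_iff)
  moreover have "card (f ` H) > 0" using H.id_mem by (simp add: card_gt_0_iff) blast
  ultimately have "p ^ r \<le> card (f ` H)" by (rule dvd_imp_le)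
  moreover have "card (f ` H) \<le> r"
  proof -
    have "f ` H \<subseteq> (\<lambda>i x. x ^ (p ^ i)) ` {..<r}"
    proof
      fix k assume "k \<in> f ` H"
      then obtain h where h: "h \<in> H" "k = f h" by blast
      then obtain a i where "a \<noteq> 0" "h = (\<lambda>x. a * x ^ (p ^ i))" using form by metis
      hence k: "k = (\<lambda>x. x ^ (p ^ i))" by (simp add: f_def h(2))
      \<comment> \<open>Adding multiples of \<open>r\<close> to the Frobenius exponent does not
        change the power map, so exponents below \<open>r\<close> suffice.\<close>
      have "x ^ (p ^ (i mod r + r * n)) = x ^ (p ^ (i mod r))" for x :: 'a and n
      proof (induction n)
        case (Suc n)
        have "x ^ (p ^ (i mod r + r * Suc n)) = (x ^ (p ^ (i mod r + r * n))) ^ (p ^ r)"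
          by (simp add: power_add power_mult[symmetric] mult_ac)
        thus ?case using Suc power_card[of "x ^ (p ^ (i mod r + r * n))"] by (simp add: card_eq)
      qed simp
      from this[of _ "i div r"] have "k = (\<lambda>x. x ^ (p ^ (i mod r)))" by (simp add: k)
      thus "k \<in> (\<lambda>i x. x ^ (p ^ i)) ` {..<r}" using r_pos by auto
    qed
    thus ?thesis using surj_card_le[of "{..<r}" "f ` H"] by simp
  qed
  moreover have "r < p ^ r" using prime_gt_1_nat[OF prime] by (simp add: power_gt_expt)
  ultimately show False by simp
qed

text \<open>Otherwise the size of an orbit on pairs forces \<open>p ^ r dvd card H\<close>. If
  \<open>V\<close> is trivial, the diagonal has this effect; if not, the pairs of points in
  different cosets of \<open>V\<close> do.\<close>

lemma V_eq_UNIV: "V = UNIV"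
proof (rule ccontr)
  assume "V \<noteq> UNIV"
  then obtain u where u: "u \<notin> V" by blast
  show False
  proof (cases "V = {0}")
    case True
    have "(\<lambda>g. (g 0, g 0)) ` G = (\<lambda>x. (x, x)) ` UNIV"
    proof (intro equalityI subsetI)
      fix z assume "z \<in> range (\<lambda>x::'a. (x, x))"
      then obtain x where "z = (x, x)" by blast
      moreover obtain g where "g \<in> G" "g 0 = x" using transitive' by blast
      ultimately show "z \<in> (\<lambda>g. (g 0, g 0)) ` G" by blast
    qed auto
    hence "card ((\<lambda>g. (g 0, g 0)) ` G) = p ^ r"
      by (simp add: card_image inj_on_def card_eq)
    hence "p ^ r dvd card G" by (metis card_pair_orbit_dvd)
    thus False using not_dvd_card_H by (simp add: card_G True)
  next
    case False
    then obtain v where v: "v \<in> V" "v \<noteq> 0" using V_zero by blast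
    \<comment> \<open>An invariant relation, so its complement off the diagonal is one orbit, of size \<open>q * (q - card V)\<close>.\<close>
    define R where "R = {(x, y). y - x \<in> V \<and> x \<noteq> y}"
    have inv_R: "(g x, g y) \<in> R" if "g \<in> G" "(x, y) \<in> R" for g x y
    proof -
      have "g y - g x = linear_part g (y - x)" using apply_add_linear_part[OF that(1), of x "y - x"] by simp
      thus ?thesis using that V_invariant bij[OF that(1)] by (auto simp: R_def bij_def inj_eq)
    qed
    have R_iff: "(g x, g y) \<in> R \<longleftrightarrow> (x, y) \<in> R" if "g \<in> G" for g x y
      using inv_R[OF that, of x y] inv_R[OF inv_mem[OF that], of "g x" "g y"] bij[OF that]
      by (auto simp: bij_is_inj)
    have u0: "u \<noteq> 0" using u V_zero by auto
    have "(\<lambda>g. (g 0, g u)) ` G = (\<lambda>(x, w). (x, x + w)) ` (UNIV \<times> (- V))"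
    proof (intro equalityI subsetI)
      fix z assume "z \<in> (\<lambda>g. (g 0, g u)) ` G"
      then obtain g where g: "g \<in> G" "z = (g 0, g u)" by blast
      have "(g 0, g u) \<notin> R" using R_iff[OF g(1)] u by (simp add: R_def)
      moreover have "g 0 \<noteq> g u" using bij[OF g(1)] u0 by (simp add: bij_def inj_eq)
      ultimately have "g u - g 0 \<notin> V" by (simp add: R_def)
      thus "z \<in> (\<lambda>(x, w). (x, x + w)) ` (UNIV \<times> (- V))"
        by (intro image_eqI[of _ _ "(g 0, g u - g 0)"]) (simp_all add: g)
    next
      fix z assume "z \<in> (\<lambda>(x, w). (x, x + w)) ` (UNIV \<times> (- V))"
      then obtain x w where w: "z = (x, x + w)" "w \<notin> V" by auto
      have "\<exists>g\<in>G. g 0 = x \<and> g u = x + w"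
      proof (rule rank_three_same_orbit[OF rank R_iff])
        show "irrefl R" by (simp add: R_def irrefl_def)
        show "(0, v) \<in> R" "(0, u) \<notin> R" "0 \<noteq> u" using u u0 v by (auto simp: R_def)
        show "x \<noteq> x + w" "(0, u) \<in> R \<longleftrightarrow> (x, x + w) \<in> R"
          using w V_zero u by (auto simp: R_def)
      qed (use u0 in auto)
      thus "z \<in> (\<lambda>g. (g 0, g u)) ` G" using w(1) by force
    qed
    moreover have "inj_on (\<lambda>(x, w). (x, x + w)) (UNIV \<times> (- V))" by (auto simp: inj_on_def)
    ultimately have "card ((\<lambda>g. (g 0, g u)) ` G) = p ^ r * card (- V)"
      by (simp add: card_image card_cartesian_product card_eq)
    also have "card (- V) = p ^ r - card V" 
      by (simp add: Compl_eq_Diff_UNIV card_Diff_subset card_eq)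
    finally have dvd: "p ^ r * (p ^ r - card V) dvd card H * card V"
      using card_pair_orbit_dvd[of 0 u] by (simp add: card_G)
    \<comment> \<open>Lagrange's theorem in the group of all translations makes
      \<open>card V\<close> a power of \<open>p\<close>.\<close>
    have "permutation_subgroup (range (\<lambda>v x. x + v :: 'a))"
      by (rule permutation_subgroup_translations) simp_all
    then interpret T: permutation_subgroup "range (\<lambda>v x. x + v :: 'a)" .
    have "card ((\<lambda>v x. x + v) ` V) dvd card (range (\<lambda>v x. x + v :: 'a))"
      by (intro T.card_subgroup_dvd permutation_subgroup_translations V_zero V_add V_uminus)
        (assumption | blast)+
    hence "card V dvd p ^ r" by (simp add: card_translations card_eq)
    then obtain s where s: "card V = p ^ s" "s \<le> r" using prime by (auto simp: divides_primepow_nat)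
    have "card V < p ^ r"
      using psubset_card_mono[of UNIV V] \<open>V \<noteq> UNIV\<close> by (auto simp: card_eq)
    \<comment> \<open>\<open>p ^ s\<close> divides both terms of the difference; cancelling it
      against \<open>card V\<close> leaves \<open>p ^ r dvd card H\<close>.\<close>
    have "p ^ s dvd p ^ r - card V"
      unfolding s(1) by (intro dvd_diff_nat le_imp_power_dvd s(2) dvd_refl)
    hence "p ^ r * p ^ s dvd card H * p ^ s" using dvd unfolding s(1) by (meson dvd_trans mult_dvd_mono dvd_refl)
    thus False using not_dvd_card_H prime_gt_0_nat[OF prime] by simp
  qed
qed

end

section \<open>Logarithms to the base of a generator\<close>

lemma exists_mult_generator: "\<exists>\<omega> :: 'a::{field,finite}. mult_generator \<omega>"
proof -
  \<comment> \<open>The type is viewed as a field of HOL-Algebra, where finite fields are known to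
    have cyclic multiplicative groups.\<close>
  define R :: "'a ring" where
    "R = \<lparr>carrier = UNIV, monoid.mult = (*), one = 1, zero = 0, add = (+)\<rparr>"
  have R: "carrier R = UNIV" "\<zero>\<^bsub>R\<^esub> = 0" "\<one>\<^bsub>R\<^esub> = 1" "\<And>x y. x \<otimes>\<^bsub>R\<^esub> y = x * y"
    "\<And>x y. x \<oplus>\<^bsub>R\<^esub> y = x + y"
    by (simp_all add: R_def)
  have "cring R"
  proof (rule cringI)
    show "abelian_group R"
      by (rule abelian_groupI) (auto simp: R add_ac intro: exI[of _ "- x" for x])
    show "Group.comm_monoid R"
      by (rule comm_monoidI) (auto simp: R mult_ac)
  qed (simp add: R distrib_right)
  then interpret R: field R
    by (rule cring.cring_fieldI2) (simp_all add: R, metis right_inverse)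
  have pow: "x [^]\<^bsub>R\<^esub> i = x ^ i" for x and i :: nat
    by (induction i) (simp_all add: R mult.commute)
  have "finite (carrier R)" by (simp add: R)
  from R.finite_field_mult_group_has_gen[OF this] obtain w
    where "w \<in> carrier (mult_of R)" "carrier (mult_of R) = {w [^]\<^bsub>R\<^esub> i | i::nat. i \<in> UNIV}"
    by blast
  hence w: "w \<noteq> 0" "UNIV - {0} = {w ^ i | i::nat. True}" by (simp_all add: R pow)
  have "cyclic_subgroup w = UNIV - {0}"
  proof
    show "cyclic_subgroup w \<subseteq> UNIV - {0}" using w(1) by (auto simp: cyclic_subgroup_def)
    show "UNIV - {0} \<subseteq> cyclic_subgroup w"
      unfolding w(2) cyclic_subgroup_def by (auto intro: range_eqI[of _ _ "int i" for i] simp flip: power_int_of_nat)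
  qed
  thus ?thesis unfolding mult_generator_def by blast
qed

lemma mult_generator_nonzero: "mult_generator \<omega> \<Longrightarrow> \<omega> \<noteq> 0"
proof -
  assume "mult_generator \<omega>"
  moreover have "\<omega> powi 1 \<in> cyclic_subgroup \<omega>" unfolding cyclic_subgroup_def by (rule rangeI)
  ultimately show ?thesis by (simp add: mult_generator_def)
qed

lemma mult_generator_powi: "mult_generator \<omega> \<Longrightarrow> x \<noteq> 0 \<Longrightarrow> \<exists>z. x = \<omega> powi z"
  by (auto simp: mult_generator_def cyclic_subgroup_def set_eq_iff)

text \<open>With exponents reduced modulo \<open>n\<close>, the \<open>n\<close> powers cover the
  \<open>n\<close> nonzero elements, so distinct reduced exponents give distinct powers.\<close>

lemma mult_generator_powi_eq_1_iff:
  fixes \<omega> :: "'a::{field,finite}"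
  assumes "mult_generator \<omega>"
  shows "\<omega> powi z = 1 \<longleftrightarrow> int (CARD('a) - 1) dvd z"
proof -
  define n where "n = CARD('a) - 1"
  have w: "\<omega> \<noteq> 0" using assms by (rule mult_generator_nonzero)
  have card: "card (UNIV - {0::'a}) = n" by (simp add: n_def)
  have "1 \<in> UNIV - {0::'a}" by simp
  hence n_pos: "n > 0" unfolding card[symmetric] by (metis card_gt_0_iff empty_iff finite)
  have n1: "\<omega> ^ n = 1" unfolding n_def using w by (rule power_card_minus_1)
  have red: "\<omega> powi z = \<omega> ^ nat (z mod int n)" for z
  proof -
    have "\<omega> powi z = \<omega> powi (int n * (z div int n) + z mod int n)" by simp
    also have "\<dots> = (\<omega> ^ n) powi (z div int n) * \<omega> powi (z mod int n)"
      using w by (subst power_int_add) (simp_all add: power_int_mult)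
    also have "\<omega> powi (z mod int n) = \<omega> ^ nat (z mod int n)"
      using n_pos by (simp add: power_int_def)
    finally show ?thesis by (simp add: n1)
  qed
  have "UNIV - {0} \<subseteq> (\<lambda>i. \<omega> ^ i) ` {..<n}"
  proof
    fix x :: 'a assume "x \<in> UNIV - {0}"
    then obtain z where "x = \<omega> powi z" using mult_generator_powi[OF assms] by blast
    moreover have "nat (z mod int n) < n" using n_pos by (simp add: nat_less_iff)
    ultimately show "x \<in> (\<lambda>i. \<omega> ^ i) ` {..<n}" unfolding red by blast
  qed
  hence "(\<lambda>i. \<omega> ^ i) ` {..<n} = UNIV - {0}" using w by auto
  hence inj: "inj_on (\<lambda>i. \<omega> ^ i) {..<n}" using card by (intro eq_card_imp_inj_on) auto
  have "nat (z mod int n) < n" using n_pos by (simp add: nat_less_iff)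
  hence "\<omega> ^ nat (z mod int n) = \<omega> ^ 0 \<longleftrightarrow> nat (z mod int n) = 0"
    using inj n_pos by (subst inj_on_eq_iff[OF inj]) auto
  also have "\<dots> \<longleftrightarrow> int n dvd z"
  proof -
    have "z mod int n \<ge> 0" using n_pos by simp
    thus ?thesis by (auto simp: dvd_eq_mod_eq_0)
  qed
  finally show ?thesis by (simp add: red n_def)
qed

text \<open>An element determines its exponent only modulo \<open>CARD('a) - 1\<close>; as
  \<open>m\<close> divides this number, divisibility of the exponent by \<open>m\<close> is well
  defined.\<close>

lemma powi_mem_cyclic_subgroup:
  fixes \<omega> :: "'a::{field,finite}"
  assumes "mult_generator \<omega>" "m dvd CARD('a) - 1"
  shows "\<omega> powi z \<in> cyclic_subgroup (\<omega> ^ m) \<longleftrightarrow> int m dvd z"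
proof -
  have w: "\<omega> \<noteq> 0" using assms(1) by (rule mult_generator_nonzero)
  have pow: "(\<omega> ^ m) powi k = \<omega> powi (int m * k)" for k by (simp add: power_int_mult)
  show ?thesis
  proof
    assume "\<omega> powi z \<in> cyclic_subgroup (\<omega> ^ m)"
    then obtain k where "\<omega> powi z = \<omega> powi (int m * k)" by (auto simp: cyclic_subgroup_def pow)
    hence "\<omega> powi (z - int m * k) = 1" using w by (simp add: power_int_diff)
    hence "int (CARD('a) - 1) dvd z - int m * k" using mult_generator_powi_eq_1_iff[OF assms(1)] by simp
    hence "int m dvd z - int m * k" using assms(2) by (meson dvd_trans int_dvd_int_iff)
    thus "int m dvd z" by (metis diff_add_cancel dvd_add dvd_triv_left)
  next
    assume "int m dvd z"
    then obtain k where "z = int m * k" by (elim dvdE)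
    thus "\<omega> powi z \<in> cyclic_subgroup (\<omega> ^ m)" unfolding cyclic_subgroup_def using pow by (metis rangeI)
  qed
qed

lemma zero_not_in_cyclic_subgroup: "g \<noteq> 0 \<Longrightarrow> 0 \<notin> cyclic_subgroup g"
  by (auto simp: cyclic_subgroup_def)

section \<open>Recognizing the Cayley graphs\<close>

lemma scaled_Cay_isomorphic:
  fixes c :: "'a::field"
  assumes "c \<noteq> 0" and "\<And>x. x \<in> S \<longleftrightarrow> c * x \<in> T"
  shows "graph_isomorphic (Cay S) (Cay T)"
proof -
  have "bij (\<lambda>x. c * x)"
    by (rule bij_betwI[of _ _ _ "\<lambda>x. x / c"]) (use assms(1) in auto)
  hence "is_graph_iso (\<lambda>x. c * x) (Cay S) (Cay T)"
    using assms(2) by (simp add: is_graph_iso_def Cay_def right_diff_distrib)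
  thus ?thesis unfolding graph_isomorphic_def by blast
qed

lemma uminus_image_eq:
  fixes S :: "'a::group_add set"
  assumes "\<And>x. - x \<in> S \<longleftrightarrow> x \<in> S"
  shows "uminus ` S = S"
proof (intro equalityI subsetI)
  fix x assume "x \<in> S"
  thus "x \<in> uminus ` S" using assms[of x] by (intro image_eqI[of _ _ "- x"]) simp_all
qed (use assms in auto)

text \<open>Multiplication by \<open>\<omega> powi (- z0)\<close> carries the coset \<open>S\<close>
  to the subgroup generated by \<open>\<omega> ^ m\<close> and preserves symmetry under
  negation.\<close>

lemma van_lint_schrijver_isomorphic:
  fixes S :: "'a::{field,finite} set"
  assumes "prime p" "r > 0" "CARD('a) = p ^ r" "mult_generator \<omega>"
    and m: "prime m" "m \<noteq> p" "ord m p = m - 1" "m dvd p ^ r - 1"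
    and S: "0 \<notin> S" "uminus ` S = S" "\<And>z. \<omega> powi z \<in> S \<longleftrightarrow> int m dvd z - z0"
  shows "\<exists>\<Delta> :: 'a rel. van_lint_schrijver_graph p \<Delta> \<and> graph_isomorphic (Cay S) \<Delta>"
proof -
  define T where "T = cyclic_subgroup (\<omega> ^ m)"
  define c where "c = \<omega> powi (- z0)"
  have w: "\<omega> \<noteq> 0" using assms(4) by (rule mult_generator_nonzero)
  hence c: "c \<noteq> 0" by (simp add: c_def)
  have ST: "x \<in> S \<longleftrightarrow> c * x \<in> T" for x
  proof (cases "x = 0")
    case True
    thus ?thesis using S(1) w zero_not_in_cyclic_subgroup[of "\<omega> ^ m"] by (simp add: T_def)
  next
    case False
    then obtain z where z: "x = \<omega> powi z" using mult_generator_powi[OF assms(4)] by blast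
    hence "c * x = \<omega> powi (z - z0)" using w by (simp add: c_def power_int_diff power_int_minus divide_inverse mult.commute)
    thus ?thesis using S(3) powi_mem_cyclic_subgroup[OF assms(4), of m] m(4) z by (simp add: T_def assms(3))
  qed
  have sym: "- x \<in> S \<longleftrightarrow> x \<in> S" for x
    using S(2) by (metis add.inverse_inverse image_eqI)
  have "- x \<in> T \<longleftrightarrow> x \<in> T" for x
    using ST[of "x / c"] ST[of "- (x / c)"] sym c by simp
  hence T: "T = uminus ` T" by (rule uminus_image_eq[symmetric])
  \<comment> \<open>As \<open>p ^ r\<close> is \<open>1\<close> modulo \<open>m\<close>, the order
    \<open>m - 1\<close> of \<open>p\<close> divides \<open>r\<close>; this provides
    \<open>k\<close>.\<close>
  have "[p ^ r = 1] (mod m)"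
  proof -
    have "[p ^ r - 1 + 1 = 0 + 1] (mod m)" using m(4) by (intro cong_add) (simp_all add: cong_0_iff)
    moreover have "p ^ r > 0" using prime_gt_0_nat[OF assms(1)] by simp
    ultimately show ?thesis by simp
  qed
  hence "m - 1 dvd r" using m(3) by (metis ord_divides)
  then obtain k where k: "r = (m - 1) * k" by (elim dvdE)
  have "van_lint_schrijver_graph p (Cay T)"
    unfolding van_lint_schrijver_graph_def
    using k m assms(2-4) T unfolding T_def by (intro exI[of _ m] exI[of _ k] exI[of _ \<omega>]) auto
  thus ?thesis using scaled_Cay_isomorphic[OF c ST] by blast
qed

text \<open>Multiplication by \<open>\<omega> powi (- j)\<close> shifts the exponent residues
  \<open>j\<close> and \<open>j + 1\<close> modulo \<open>4\<close> to \<open>0\<close> and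
  \<open>1\<close>, those of the Peisert connection set.\<close>

lemma peisert_isomorphic:
  fixes S :: "'a::{field,finite} set"
  assumes "CARD('a) = p ^ r" "mult_generator \<omega>"
    and p: "p mod 4 = 3" "4 dvd p ^ r - 1"
    and S: "0 \<notin> S" "\<And>z. \<omega> powi z \<in> S \<longleftrightarrow> (z - j) mod 4 \<in> {0, 1}"
  shows "\<exists>\<Delta> :: 'a rel. peisert_graph p \<Delta> \<and> graph_isomorphic (Cay S) \<Delta>"
proof -
  define D where "D = cyclic_subgroup (\<omega> ^ 4)"
  define T where "T = D \<union> (\<lambda>c. c * \<omega>) ` D"
  define c where "c = \<omega> powi (- j)"
  have w: "\<omega> \<noteq> 0" using assms(2) by (rule mult_generator_nonzero)
  hence c: "c \<noteq> 0" by (simp add: c_def)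
  have D: "\<omega> powi z \<in> D \<longleftrightarrow> 4 dvd z" for z
    using powi_mem_cyclic_subgroup[OF assms(2), of 4] p(2) by (simp add: D_def assms(1))
  have D0: "0 \<notin> D" using w zero_not_in_cyclic_subgroup[of "\<omega> ^ 4"] by (simp add: D_def)
  have T: "\<omega> powi z \<in> T \<longleftrightarrow> z mod 4 \<in> {0, 1}" for z
  proof -
    have "\<omega> powi z \<in> (\<lambda>c. c * \<omega>) ` D \<longleftrightarrow> \<omega> powi (z - 1) \<in> D"
    proof -
      have "\<omega> powi z = \<omega> powi (z - 1) * \<omega>" using w by (simp add: power_int_diff)
      thus ?thesis using w by (metis (no_types, lifting) image_iff mult_cancel_right)
    qed
    hence "\<omega> powi z \<in> T \<longleftrightarrow> 4 dvd z \<or> 4 dvd z - 1" by (simp add: T_def D)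
    thus ?thesis by simp presburger
  qed
  have ST: "x \<in> S \<longleftrightarrow> c * x \<in> T" for x
  proof (cases "x = 0")
    case True
    thus ?thesis using S(1) w D0 by (auto simp: T_def)
  next
    case False
    then obtain z where z: "x = \<omega> powi z" using mult_generator_powi[OF assms(2)] by blast
    hence "c * x = \<omega> powi (z - j)" using w by (simp add: c_def power_int_diff power_int_minus divide_inverse mult.commute)
    thus ?thesis using S(2) T z by simp
  qed
  \<comment> \<open>For odd \<open>r\<close>, \<open>p ^ r\<close> would be \<open>3\<close> modulo
    \<open>4\<close>.\<close>
  have "even r"
  proof (rule ccontr)
    assume "odd r"
    then obtain k where k: "r = 2 * k + 1" by (elim oddE)
    have "[p ^ 2 = 3 ^ 2] (mod 4)" using p(1) by (intro cong_pow) (simp add: cong_def)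
    hence "[p ^ 2 = 1] (mod 4)" by (simp add: cong_def)
    hence "[(p ^ 2) ^ k * p = 1 ^ k * 3] (mod 4)"
      using p(1) by (intro cong_mult cong_pow) (simp_all add: cong_def)
    moreover have "p ^ r = (p ^ 2) ^ k * p" by (simp only: k power_add power_mult power_one_right)
    ultimately have "p ^ r mod 4 = 3" by (simp only: cong_def) simp
    thus False using p(2) by presburger
  qed
  hence "peisert_graph p (Cay T)"
    unfolding peisert_graph_def T_def D_def using assms(1,2) p(1) by blast
  thus ?thesis using scaled_Cay_isomorphic[OF c ST] by blast
qed

text \<open>Affine maps are transitive on ordered pairs of distinct points, so only the diagonal and
  its complement are orbits. This serves to rule out empty and complete graphs.\<close>

lemma perm_rank_all_affine_maps:
  fixes G :: "('a::{field,finite} \<Rightarrow> 'a) set"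
  assumes "\<And>a b. a \<noteq> 0 \<Longrightarrow> (\<lambda>x. a * x + b) \<in> G" and "\<And>g. g \<in> G \<Longrightarrow> bij g"
  shows "perm_rank G \<le> 2"
proof -
  have diag: "(\<lambda>g. (g x, g x)) ` G = Id" for x
  proof (intro equalityI subsetI)
    fix z :: "'a \<times> 'a" assume "z \<in> Id"
    then obtain u where "z = (u, u)" by auto
    thus "z \<in> (\<lambda>g. (g x, g x)) ` G"
      using assms(1)[of 1 "u - x"] by (intro image_eqI[of _ _ "\<lambda>y. 1 * y + (u - x)"]) auto
  qed auto
  have off: "(\<lambda>g. (g x, g y)) ` G = - Id" if "x \<noteq> y" for x y
  proof (intro equalityI subsetI)
    fix z assume "z \<in> (\<lambda>g. (g x, g y)) ` G"
    then obtain g where "g \<in> G" "z = (g x, g y)" by blast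
    thus "z \<in> - Id" using assms(2)[of g] that by (auto simp: bij_def inj_eq)
  next
    fix z :: "'a \<times> 'a" assume "z \<in> - Id"
    then obtain u v where z: "z = (u, v)" "u \<noteq> v" by (cases z) auto
    \<comment> \<open>The slope of the affine map that takes \<open>x\<close> to \<open>u\<close>
      and \<open>y\<close> to \<open>v\<close>.\<close>
    define a where "a = (v - u) / (y - x)"
    have "a \<noteq> 0" "a * y + (u - a * x) = v"
      using z(2) that by (simp_all add: a_def right_diff_distrib[symmetric] algebra_simps)
        (simp add: divide_simps, simp add: algebra_simps)
    thus "z \<in> (\<lambda>g. (g x, g y)) ` G"
      using assms(1)[of a "u - a * x"]
      by (intro image_eqI[of _ _ "\<lambda>w. a * w + (u - a * x)"]) (auto simp: z)
  qed
  have "(\<lambda>g. (g x, g y)) ` G \<in> {Id, - Id}" for x y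
    using diag[of x] off[of x y] by (cases "x = y") simp_all
  hence "range (\<lambda>(x, y). (\<lambda>g. (g x, g y)) ` G) \<subseteq> {Id, - Id}" by (auto split: prod.splits)
  hence "perm_rank G \<le> card {Id, - Id :: ('a \<times> 'a) set}"
    unfolding perm_rank_eq by (intro card_mono) auto
  also have "\<dots> \<le> 2" by (simp add: card_insert_if)
  finally show ?thesis .
qed

section \<open>From the graph to its exponent set and back\<close>

theorem theorem3:
  fixes p r :: nat and \<Gamma> :: "('a::{field,finite}) rel"
  assumes "prime p" and "r > 0" and "CARD('a) = p ^ r"
    and "affine_rank_three_graph p \<Gamma>"
  shows "\<exists>\<Delta> :: 'a rel.
    (van_lint_schrijver_graph p \<Delta> \<or> paley_graph \<Delta> \<or> peisert_graph p \<Delta>) \<and>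
    (graph_isomorphic \<Gamma> \<Delta> \<or> graph_isomorphic (graph_complement \<Gamma>) \<Delta>)"
proof -
  define G where "G = graph_Aut \<Gamma> \<inter> AGammaL1 p"
  have graph: "sym \<Gamma>" "irrefl \<Gamma>" and rank: "rank_three_group G"
    using assms(4) by (simp_all add: affine_rank_three_graph_def is_graph_def G_def)
  interpret affine_rank_three p r G
  proof (rule affine_rank_three.intro)
    show "G \<subseteq> AGammaL1 p" by (simp add: G_def)
  qed (use assms(1-3) rank in \<open>simp_all add: rank_three_group_def\<close>)
  have inv: "(g x, g y) \<in> \<Gamma> \<longleftrightarrow> (x, y) \<in> \<Gamma>" if "g \<in> G" for g x y
    using that by (auto simp: G_def graph_Aut_def is_graph_iso_def)
  \<comment> \<open>An empty or complete graph is preserved by all affine maps, and then the rank is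
    at most \<open>2\<close>.\<close>
  have "\<Gamma> \<noteq> {} \<and> \<Gamma> \<noteq> - Id"
  proof (rule ccontr)
    assume *: "\<not> (\<Gamma> \<noteq> {} \<and> \<Gamma> \<noteq> - Id)"
    have "(\<lambda>x. a * x + b) \<in> G" if "a \<noteq> 0" for a b
    proof -
      have "bij (\<lambda>x. a * x + b)"
        by (rule bij_betwI[of _ _ _ "\<lambda>x. (x - b) / a"]) (use that in auto)
      hence "(\<lambda>x. a * x + b) \<in> graph_Aut \<Gamma>"
        using * that by (auto simp: graph_Aut_def is_graph_iso_def)
      moreover have "(\<lambda>x. a * x + b) \<in> AGammaL1 p"
        using that unfolding AGammaL1_def by (intro CollectI exI[of _ a] exI[of _ b] exI[of _ 0]) simp
      ultimately show ?thesis by (simp add: G_def)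
    qed
    hence "perm_rank G \<le> 2" using bij by (rule perm_rank_all_affine_maps)
    thus False using affine_rank_three.rank[OF affine_rank_three_axioms] by simp
  qed
  then obtain a b c d where ab: "(a, b) \<in> \<Gamma>" and cd: "(c, d) \<notin> \<Gamma>" "c \<noteq> d"
    using graph(2) unfolding irrefl_def by auto
  define S where "S = {z. (0, z) \<in> \<Gamma>}"
  have trans: "(x, y) \<in> \<Gamma> \<longleftrightarrow> y - x \<in> S" for x y
  proof -
    have "x \<in> V" by (simp add: V_eq_UNIV)
    hence "(\<lambda>z. z + x) \<in> G" by (simp add: V_def)
    from inv[OF this, of 0 "y - x"] show ?thesis by (simp add: S_def)
  qed
  have Cay_S: "\<Gamma> = Cay S" by (auto simp: Cay_def trans)
  have S0: "0 \<notin> S" using graph(2) by (simp add: S_def irrefl_def)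
  have Cay_compl: "graph_complement \<Gamma> = Cay (- S - {0})"
    by (auto simp: graph_complement_def Cay_def trans)
  have S_sym: "- x \<in> S \<longleftrightarrow> x \<in> S" for x
    using graph(1) trans[of 0 x] trans[of x 0] by (auto simp: sym_def)
  obtain \<omega> :: 'a where \<omega>: "mult_generator \<omega>" using exists_mult_generator by blast
  have w: "\<omega> \<noteq> 0" using \<omega> by (rule mult_generator_nonzero)
  define \<Sigma> where "\<Sigma> = {z. \<omega> powi z \<in> S}"
  interpret E: semilinear_two_orbits p "p ^ r - 1" r \<Sigma>
  proof
    show "prime p" "r > 0" "p ^ r - 1 = p ^ r - 1" using assms by simp_all
    have "\<omega> powi (z + int (p ^ r - 1)) = \<omega> powi z * \<omega> ^ (p ^ r - 1)" for z
      using w by (subst power_int_add) (simp_all only: power_int_of_nat simp_thms)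
    moreover have "\<omega> ^ (p ^ r - 1) = 1" using power_card_minus_1[OF w] by (simp only: assms(3))
    ultimately show "z + int (p ^ r - 1) \<in> \<Sigma> \<longleftrightarrow> z \<in> \<Sigma>" for z
      by (simp only: \<Sigma>_def mem_Collect_eq mult_1_right)
    have "b - a \<in> S" "b - a \<noteq> 0" using ab graph(2) by (auto simp: trans[symmetric] irrefl_def)
    thus "\<Sigma> \<noteq> {}" using mult_generator_powi[OF \<omega>, of "b - a"] by (auto simp: \<Sigma>_def)
    have "d - c \<notin> S" "d - c \<noteq> 0" using cd by (auto simp: trans[symmetric])
    thus "\<Sigma> \<noteq> UNIV" using mult_generator_powi[OF \<omega>, of "d - c"] by (auto simp: \<Sigma>_def)
    fix x y assume xy: "x \<in> \<Sigma> \<longleftrightarrow> y \<in> \<Sigma>"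
    \<comment> \<open>The pairs \<open>(0, \<omega> powi x)\<close> and
      \<open>(0, \<omega> powi y)\<close> are both arcs or both non-arcs, so some element of
      \<open>G\<close> maps one to the other; fixing \<open>0\<close>, it equals its linear
      part.\<close>
    have "\<exists>g\<in>G. g 0 = 0 \<and> g (\<omega> powi x) = \<omega> powi y"
      using w xy by (intro rank_three_same_orbit[OF affine_rank_three.rank[OF affine_rank_three_axioms]
            inv graph(2) ab cd]) (auto simp: \<Sigma>_def S_def)
    then obtain g where g: "g \<in> G" "g 0 = 0" "g (\<omega> powi x) = \<omega> powi y" by blast
    obtain e i where "linear_part g = (\<lambda>x. e * x ^ (p ^ i))" using linear_part_form[OF g(1)] by blast
    hence ge: "g z = e * z ^ (p ^ i)" for z by (simp add: linear_part_def g(2) fun_eq_iff)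
    have pow: "(\<omega> powi z) ^ (p ^ i) = \<omega> powi (int p ^ i * z)" for z
      by (metis mult.commute of_nat_power power_int_mult power_int_of_nat)
    \<comment> \<open>This logarithm of \<open>e\<close> makes the exponent map send \<open>x\<close> to \<open>y\<close> exactly, not only modulo
      \<open>p ^ r - 1\<close>.\<close>
    define k where "k = y - int p ^ i * x"
    have "\<omega> powi y = e * \<omega> powi (int p ^ i * x)" using g(3) by (simp only: ge pow)
    hence e: "e = \<omega> powi k" using w by (simp add: k_def power_int_diff)
    have "\<omega> powi (int p ^ i * z + k) = g (\<omega> powi z)" for z
      using w by (simp add: ge pow e power_int_add mult.commute)
    hence "int p ^ i * z + k \<in> \<Sigma> \<longleftrightarrow> z \<in> \<Sigma>" for z
      using inv[OF g(1), of 0 "\<omega> powi z"] by (simp add: \<Sigma>_def S_def g(2))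
    thus "\<exists>c i. (\<forall>z. int p ^ i * z + c \<in> \<Sigma> \<longleftrightarrow> z \<in> \<Sigma>) \<and> int p ^ i * x + c = y"
      by (intro exI[of _ k] exI[of _ i]) (simp add: k_def)
  qed
  \<comment> \<open>\<open>- S - {0}\<close> is the connection set of the complement graph and
    \<open>- \<Sigma>\<close> its set of exponents, so the alternatives about
    \<open>- \<Sigma>\<close> speak about that graph.\<close>
  have compl: "\<omega> powi z \<in> - S - {0} \<longleftrightarrow> z \<in> - \<Sigma>" for z using w by (simp add: \<Sigma>_def)
  have neg: "uminus ` S = S" "uminus ` (- S - {0}) = - S - {0}"
    by (rule uminus_image_eq, simp add: S_sym)+
  from E.classification show ?thesis
  proof (elim disjE exE conjE)
    fix m z0
    assume m: "prime m" "m \<noteq> p" "ord m p = m - 1" "m dvd p ^ r - 1"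
      and \<Sigma>: "\<Sigma> = {z. int m dvd z - z0}"
    have "\<omega> powi z \<in> S \<longleftrightarrow> int m dvd z - z0" for z
      using \<Sigma> unfolding \<Sigma>_def by (metis mem_Collect_eq)
    from van_lint_schrijver_isomorphic[OF assms(1-3) \<omega> m S0 neg(1) this]
    show ?thesis unfolding Cay_S by blast
  next
    fix m z0
    assume m: "prime m" "m \<noteq> p" "ord m p = m - 1" "m dvd p ^ r - 1"
      and \<Sigma>: "- \<Sigma> = {z. int m dvd z - z0}"
    have "\<omega> powi z \<in> - S - {0} \<longleftrightarrow> int m dvd z - z0" for z
      unfolding compl \<Sigma> by (rule mem_Collect_eq)
    from van_lint_schrijver_isomorphic[OF assms(1-3) \<omega> m _ neg(2) this]
    show ?thesis unfolding Cay_compl by blast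
  next
    fix j
    assume p: "4 dvd p ^ r - 1" "p mod 4 = 3" and \<Sigma>: "\<Sigma> = {z. (z - j) mod 4 \<in> {0, 1}}"
    have "\<omega> powi z \<in> S \<longleftrightarrow> (z - j) mod 4 \<in> {0, 1}" for z
      using \<Sigma> unfolding \<Sigma>_def by (metis (mono_tags, lifting) mem_Collect_eq)
    from peisert_isomorphic[OF assms(3) \<omega> p(2,1) S0 this]
    show ?thesis unfolding Cay_S by blast
  qed
qed

end
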